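(* Let $l,p\ge 2$ be integers with $p$ even. Then $$\frac{\big(p!\,\mu_{l,p}(\text{standard})\big)^{1/p}}{2\sqrt{3}}\le \sup_{\|b\|\le 1}\left\|\sum_{A\in \mathcal Z_l} b_Aw_A\right\|_p\le \sqrt{l!}\cdot \big(p!\,\mu_{l,p}(\text{full})\big)^{1/p},$$ where the supremum is over all finite real sequences $b=\{b_A: A\in\mathcal Z_l\}$ with $\|b\|=\big(\sum_{A\in\mathcal Z_l} |b_A|^2\big)^{1/2}\le1$, and $\|\cdot\|_p$ is the norm of $L^p(0,1)$.
   Context: Rademacher functions: $r_n(x)=\operatorname{sign}(\sin 2^n\pi x)$, $n\ge1$, $x\in(0,1)$. For a finite set $A\subset\mathbb N=\{1,2,\ldots\}$, $w_A(x)=\prod_{k\in A}r_k(x)$. $\mathcal Z_l=\{A\subset\mathbb N:\#(A)=l\}$. A sequence $\{b_A:A\in\mathcal Z_l\}$ is finite if only finitely many of its terms are nonzero. A set-collection $\mathcal A=\{A_1,\ldots,A_p\}$ is a finite family of finite sets, not necessarily different (i.e. an unordered collection with multiplicities allowed). Two set-collections $\{A_1,\ldots,A_p\}$ and $\{B_1,\ldots,B_p\}$ are equal if there is a bijection $\sigma$ of $\{1,\ldots,p\}$ with $A_{\sigma(k)}=B_k$ for all $k$. They are isomorphic if there is a bijection $\phi:\bigcup_k A_k\to\bigcup_k B_k$ such that $\{\phi(A_1),\ldots,\phi(A_p)\}=\{B_1,\ldots,B_p\}$ as set-collections; isomorphism is an equivalence relation and its classes are called E-classes. A set-collection is a double-covering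 if each $a\in\bigcup_{k=1}^pA_k$ belongs to exactly two of the sets $A_k$ (counted by index $k$). A set-collection $\mathcal A$ is connected if for any two different elements $A,B\in\mathcal A$ there is a sequence $A=E_0,E_1,\ldots,E_m=B$ with all $E_j\in\mathcal A$ and $E_j\cap E_{j+1}\ne\varnothing$ for $j=0,\ldots,m-1$. Every set-collection of nonempty sets is uniquely the union (with multiplicities) of its connected components, the maximal connected subcollections. A set-collection is standard if the E-classes of its connected components are pairwise different (no two components are isomorphic). $\mu_{l,p}(\text{full})$ is the number of E-classes of double-coverings $\{A_1,\ldots,A_p\}$ with $\#(A_k)=l$ for all $k$, and $\mu_{l,p}(\text{standard})$ is the number of E-classes of those that are standard. *)

theory Defs
  imports "HOL-Analysis.Analysis" "HOL-Library.Multiset"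
begin

text \<open>The set of positive integers is encoded by excluding 0 in \<open>index_sets\<close>.\<close>

definition rademacher :: "nat \<Rightarrow> real \<Rightarrow> real" where
  "rademacher n x = sgn (sin (2 ^ n * pi * x))"

definition walsh :: "nat set \<Rightarrow> real \<Rightarrow> real" where
  "walsh A x = (\<Prod>k\<in>A. rademacher k x)"

definition index_sets :: "nat \<Rightarrow> nat set set" where
  "index_sets l = {A. finite A \<and> 0 \<notin> A \<and> card A = l}"

text \<open>A sequence indexed by \<open>index_sets l\<close> is a total function on sets of naturals; only its
  values on \<open>index_sets l\<close> are ever used.\<close>

definition coeff_support :: "nat \<Rightarrow> (nat set \<Rightarrow> real) \<Rightarrow> nat set set" where
  "coeff_support l b = {A \<in> index_sets l. b A \<noteq> 0}"

definition finite_coeffs :: "nat \<Rightarrow> (nat set \<Rightarrow> real) set" where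
  "finite_coeffs l = {b. finite (coeff_support l b)}"

definition coeff_norm :: "nat \<Rightarrow> (nat set \<Rightarrow> real) \<Rightarrow> real" where
  "coeff_norm l b = sqrt (\<Sum>A\<in>coeff_support l b. \<bar>b A\<bar>\<^sup>2)"

definition chaos_sum :: "nat \<Rightarrow> (nat set \<Rightarrow> real) \<Rightarrow> real \<Rightarrow> real" where
  "chaos_sum l b x = (\<Sum>A\<in>coeff_support l b. b A * walsh A x)"

definition Lp_norm :: "real \<Rightarrow> (real \<Rightarrow> real) \<Rightarrow> real" where
  "Lp_norm p f = (LINT x:{0<..<1}|lborel. \<bar>f x\<bar> powr p) powr (1 / p)"

text \<open>Set-collections are multisets of finite sets: equality of indexed families up to a
  permutation of the index set is multiset equality. Every finite collection of finite sets is
  isomorphic to one of sets of naturals, so E-classes are counted over ground type \<^typ>\<open>nat\<close>.\<close>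

definition set_collection :: "nat set multiset \<Rightarrow> bool" where
  "set_collection \<A> \<longleftrightarrow> (\<forall>X\<in>#\<A>. finite X)"

definition isomorphic_collections :: "nat set multiset \<Rightarrow> nat set multiset \<Rightarrow> bool" where
  "isomorphic_collections \<A> \<B> \<longleftrightarrow>
     (\<exists>\<phi>. bij_betw \<phi> (\<Union>(set_mset \<A>)) (\<Union>(set_mset \<B>)) \<and> image_mset (\<lambda>X. \<phi> ` X) \<A> = \<B>)"

definition iso_rel :: "(nat set multiset \<times> nat set multiset) set" where
  "iso_rel = {(\<A>, \<B>). set_collection \<A> \<and> set_collection \<B> \<and> isomorphic_collections \<A> \<B>}"

definition double_covering :: "nat set multiset \<Rightarrow> bool" where
  "double_covering \<A> \<longleftrightarrow>
     set_collection \<A> \<and> (\<forall>a\<in>\<Union>(set_mset \<A>). size (filter_mset (\<lambda>X. a \<in> X) \<A>) = 2)"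

definition connected_collection :: "nat set multiset \<Rightarrow> bool" where
  "connected_collection \<A> \<longleftrightarrow>
     (\<forall>X Y. X \<in># \<A> \<and> Y \<in># \<A> \<and> X \<noteq> Y \<longrightarrow>
        (\<exists>(E :: nat \<Rightarrow> nat set) m. E 0 = X \<and> E m = Y \<and> (\<forall>j\<le>m. E j \<in># \<A>) \<and>
           (\<forall>j<m. E j \<inter> E (Suc j) \<noteq> {})))"

definition connected_component_of_collection ::
    "nat set multiset \<Rightarrow> nat set multiset \<Rightarrow> bool" where
  "connected_component_of_collection \<A> \<C> \<longleftrightarrow>
     \<C> \<noteq> {#} \<and> \<C> \<subseteq># \<A> \<and> connected_collection \<C> \<and>
     (\<forall>\<D>. \<C> \<subseteq># \<D> \<and> \<D> \<subseteq># \<A> \<and> connected_collection \<D> \<longrightarrow> \<D> = \<C>)"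

text \<open>Components of a collection of nonempty sets have disjoint unions, so two different
  components are different as multisets and no multiplicity of components is lost below.\<close>

definition standard_collection :: "nat set multiset \<Rightarrow> bool" where
  "standard_collection \<A> \<longleftrightarrow>
     (\<forall>\<C> \<D>. connected_component_of_collection \<A> \<C> \<and>
        connected_component_of_collection \<A> \<D> \<and> \<C> \<noteq> \<D> \<longrightarrow> \<not> isomorphic_collections \<C> \<D>)"

definition double_coverings :: "nat \<Rightarrow> nat \<Rightarrow> nat set multiset set" where
  "double_coverings l p = {\<A>. double_covering \<A> \<and> size \<A> = p \<and> (\<forall>X\<in>#\<A>. card X = l)}"

definition mu_full :: "nat \<Rightarrow> nat \<Rightarrow> nat" where
  "mu_full l p = card (double_coverings l p // iso_rel)"

definition mu_standard :: "nat \<Rightarrow> nat \<Rightarrow> nat" where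
  "mu_standard l p = card ({\<A> \<in> double_coverings l p. standard_collection \<A>} // iso_rel)"

end

theory Submission
  imports Defs
begin

text \<open>For even \<open>p\<close> the \<open>p\<close>-th power of the \<open>L\<^sup>p\<close> norm of \<open>\<Sum>A. b A * walsh A\<close> is the sum of
  \<open>\<Prod>i<p. b (A i)\<close> over all \<open>p\<close>-tuples in which every point lies in an even number of the sets \<open>A i\<close>.

  Upper bound: pairing up the occurrences of each point exhibits such a tuple as \<open>\<phi> ` B i\<close> for a
  double covering \<open>B\<close>, and up to isomorphism there are at most \<open>p! \<mu>(full)\<close> ordered double coverings.
  For a fixed \<open>B\<close>, summing over all maps \<open>\<phi>\<close> and applying Cauchy--Schwarz at every point bounds the
  contribution by \<open>(l!) ^ (p/2)\<close>, since each set of size \<open>l\<close> is the image of a block under \<open>l!\<close> maps.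

  Lower bound: let \<open>b\<close> be constant on the \<open>l\<close>-subsets of \<open>{1..n}\<close>. An E-class with automorphism group
  \<open>G\<close> (acting on indices and points) contributes \<open>p! n (n - 1) \<dots> (n - v + 1) / card G\<close> tuples, where
  \<open>v = lp/2\<close> is the number of points. An automorphism of a standard double covering preserves every
  component, so exploring the blocks along intersections determines it up to the order of the newly
  found points and the image of one block per component; hence \<open>card G \<le> 2 ^ p (l!) ^ (p/2)\<close>. With
  \<open>n = 2 v\<^sup>2\<close> the falling factorial is at least \<open>n ^ v / 2\<close>.\<close>

subsection \<open>Counting and Cauchy--Schwarz\<close>

text \<open>\<open>B\<close> is arbitrary because later targets, such as an image block minus the
  points already used, are not known to match \<open>A\<close> in size. If they do not, there is no
  bijection at all.\<close>

lemma card_bijections_le: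
  assumes "finite A"
  shows "card {f \<in> A \<rightarrow>\<^sub>E B. bij_betw f A B} \<le> fact (card A)"
proof (cases "finite B \<and> card B = card A")
  case True
  have "{f \<in> A \<rightarrow>\<^sub>E B. bij_betw f A B} \<subseteq> {f \<in> A \<rightarrow>\<^sub>E B. inj_on f A}"
    by (auto simp: bij_betw_def)
  moreover have "finite {f \<in> A \<rightarrow>\<^sub>E B. inj_on f A}"
    using assms True by (intro finite_subset[OF _ finite_PiE[of A "\<lambda>_. B"]]) auto
  moreover have "(\<Prod>i=0..<n. n - i) = fact n" for n :: nat
    by (simp add: fact_prod_rev)
  ultimately show ?thesis
    using card_inj_on_subset_funcset[of A B A] assms True card_mono by fastforce
next
  case False
  then have "{f \<in> A \<rightarrow>\<^sub>E B. bij_betw f A B} = {}"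
    using assms bij_betw_same_card bij_betw_finite by force
  then show ?thesis by (simp only: card.empty)
qed

lemma card_le_card_image_mult:
  assumes "finite S" and fib: "\<And>y. y \<in> g ` S \<Longrightarrow> card {x \<in> S. g x = y} \<le> k"
  shows "card S \<le> card (g ` S) * k"
proof -
  have "S = (\<Union>y\<in>g ` S. {x \<in> S. g x = y})" by auto
  then have "card S \<le> (\<Sum>y\<in>g ` S. card {x \<in> S. g x = y})"
    using assms(1) by (metis card_UN_le finite_imageI)
  also have "\<dots> \<le> (\<Sum>y\<in>g ` S. k)" by (intro sum_mono fib)
  finally show ?thesis by simp
qed

lemma even_card_pairing:
  assumes "finite I" "even (card I)"
  obtains g :: "'a \<Rightarrow> nat" where "\<And>i. i \<in> I \<Longrightarrow> card {j \<in> I. g j = g i} = 2"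
proof -
  obtain h where h: "bij_betw h I {0..<card I}"
    using ex_bij_betw_finite_nat[OF assms(1)] by blast
  have "card {j \<in> I. h j div 2 = h i div 2} = 2" if "i \<in> I" for i
  proof -
    let ?c = "h i div 2"
    have "h i < card I" using h that by (auto simp: bij_betw_def)
    \<comment> \<open>Evenness of \<open>card I\<close> ensures that the partner of
      \<open>h i\<close> in the pair \<open>2 * ?c\<close>, \<open>2 * ?c + 1\<close> is still below
      \<open>card I\<close>.\<close>
    then have c: "2 * ?c < card I" "2 * ?c + 1 < card I" using assms(2) by presburger+
    have "h ` {j \<in> I. h j div 2 = ?c} = {n \<in> h ` I. n div 2 = ?c}" by auto
    also have "\<dots> = {2 * ?c, 2 * ?c + 1}"
      using c h by (auto simp: bij_betw_def)
    finally have "card (h ` {j \<in> I. h j div 2 = ?c}) = 2" by simp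
    moreover have "inj_on h {j \<in> I. h j div 2 = ?c}"
      using h by (auto simp: bij_betw_def intro: inj_on_subset)
    ultimately show ?thesis by (simp add: card_image)
  qed
  then show ?thesis using that[of "\<lambda>j. h j div 2"] by blast
qed

text \<open>The variables are summed out one at a time, each by the Cauchy--Schwarz inequality for the
  two factors that contain it.\<close>

lemma sum_prod_double_cover_le:
  fixes f :: "'i \<Rightarrow> ('v \<Rightarrow> 'n) \<Rightarrow> real"
  assumes "finite V" and I: "finite I" and N: "finite N"
    and "\<And>i. i \<in> I \<Longrightarrow> B i \<subseteq> V"
    and "\<And>v. v \<in> V \<Longrightarrow> card {i \<in> I. v \<in> B i} = 2"
    and "\<And>i \<psi>. 0 \<le> f i \<psi>"
  shows "(\<Sum>\<phi>\<in>V \<rightarrow>\<^sub>E N. \<Prod>i\<in>I. f i (restrict \<phi> (B i)))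
    \<le> (\<Prod>i\<in>I. sqrt (\<Sum>\<psi>\<in>B i \<rightarrow>\<^sub>E N. (f i \<psi>)\<^sup>2))"
  using assms(1,4-6)
proof (induction V arbitrary: B f rule: finite_induct)
  case empty
  \<comment> \<open>With no variables left every block is empty, and
    \<open>\<lambda>_. undefined\<close> is the only map in
    \<open>B i \<rightarrow>\<^sub>E N\<close>.\<close>
  have "sqrt (\<Sum>\<psi>\<in>B i \<rightarrow>\<^sub>E N. (f i \<psi>)\<^sup>2) = f i (\<lambda>_. undefined)" if "i \<in> I" for i
    using empty.prems(1)[OF that] empty.prems(3) by simp
  moreover have "restrict \<phi> (B i) = (\<lambda>_. undefined)" if "i \<in> I" for i \<phi>
    using empty.prems(1)[OF that] by (simp add: restrict_def)
  ultimately show ?case by simp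
next
  case (insert v V)
  define B' where "B' i = B i - {v}" for i
  \<comment> \<open>A factor containing \<open>v\<close> is replaced by its L2 norm in the value at
    \<open>v\<close>; the other factors stay as they are.\<close>
  define f' where "f' i \<psi> = (if v \<in> B i then sqrt (\<Sum>t\<in>N. (f i (\<psi>(v := t)))\<^sup>2) else f i \<psi>)" for i \<psi>
  have card2: "card {i \<in> I. v \<in> B i} = 2" using insert.prems(2) by simp
  then obtain a b where ab: "{i \<in> I. v \<in> B i} = {a, b}" "a \<noteq> b" by (auto simp: card_2_iff)
  then have aI: "a \<in> I" "v \<in> B a" and bI: "b \<in> I" "v \<in> B b" by auto
  have I_eq: "I = insert a (insert b (I - {a, b}))" using aI bI by auto
  have split: "(\<Prod>i\<in>I. h i) = h a * h b * (\<Prod>i\<in>I - {a, b}. h i)" for h :: "'i \<Rightarrow> real"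
    using ab(2) I by (subst I_eq) (simp add: mult.assoc)
  have rest: "v \<notin> B i" if "i \<in> I - {a, b}" for i using ab that by blast
  have sum_insert: "(\<Sum>\<phi>\<in>insert v W \<rightarrow>\<^sub>E N. h \<phi>) = (\<Sum>\<phi>\<in>W \<rightarrow>\<^sub>E N. \<Sum>t\<in>N. h (\<phi>(v := t)))"
    if "v \<notin> W" for W and h :: "('v \<Rightarrow> 'n) \<Rightarrow> real"
  proof -
    have "(\<Sum>\<phi>\<in>insert v W \<rightarrow>\<^sub>E N. h \<phi>) = (\<Sum>(t, \<phi>)\<in>N \<times> (W \<rightarrow>\<^sub>E N). h (\<phi>(v := t)))"
      unfolding PiE_insert_eq
      by (subst sum.reindex[OF inj_combinator[OF that, of "\<lambda>_. N"]]) (simp add: case_prod_unfold o_def)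
    also have "\<dots> = (\<Sum>\<phi>\<in>W \<rightarrow>\<^sub>E N. \<Sum>t\<in>N. h (\<phi>(v := t)))"
      by (subst sum.swap) (simp add: sum.cartesian_product)
    finally show ?thesis .
  qed
  have "(\<Sum>\<phi>\<in>insert v V \<rightarrow>\<^sub>E N. \<Prod>i\<in>I. f i (restrict \<phi> (B i)))
      = (\<Sum>\<phi>\<in>V \<rightarrow>\<^sub>E N. \<Sum>t\<in>N. \<Prod>i\<in>I. f i (restrict (\<phi>(v := t)) (B i)))"
    using insert.hyps by (simp add: sum_insert)
  also have "\<dots> \<le> (\<Sum>\<phi>\<in>V \<rightarrow>\<^sub>E N. \<Prod>i\<in>I. f' i (restrict \<phi> (B' i)))"
  proof (rule sum_mono)
    fix \<phi> assume "\<phi> \<in> V \<rightarrow>\<^sub>E N"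
    have r1: "restrict (\<phi>(v := t)) (B i) = (restrict \<phi> (B' i))(v := t)" if "v \<in> B i" for t i
      using that by (auto simp: B'_def restrict_def)
    have r2: "restrict (\<phi>(v := t)) (B i) = restrict \<phi> (B' i)" if "v \<notin> B i" for t i
      using that by (auto simp: B'_def restrict_def)
    let ?g = "\<lambda>i t. f i ((restrict \<phi> (B' i))(v := t))"
    let ?R = "\<Prod>i\<in>I - {a, b}. f i (restrict \<phi> (B' i))"
    have R: "?R \<ge> 0" using insert.prems(3) by (intro prod_nonneg) auto
    have "(\<Prod>i\<in>I. f i (restrict (\<phi>(v := t)) (B i))) = ?g a t * ?g b t * ?R" for t
    proof -
      have "(\<Prod>i\<in>I - {a, b}. f i (restrict (\<phi>(v := t)) (B i))) = ?R"
        using rest r2 by (intro prod.cong) auto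
      then show ?thesis by (subst split) (simp only: r1[OF aI(2)] r1[OF bI(2)])
    qed
    then have "(\<Sum>t\<in>N. \<Prod>i\<in>I. f i (restrict (\<phi>(v := t)) (B i))) = (\<Sum>t\<in>N. ?g a t * ?g b t) * ?R"
      by (simp add: sum_distrib_right)
    also have "\<dots> \<le> (L2_set (?g a) N * L2_set (?g b) N) * ?R"
      using L2_set_mult_ineq[of "?g a" "?g b" N] insert.prems(3)
      by (intro mult_right_mono[OF _ R]) simp
    also have "\<dots> = (\<Prod>i\<in>I. f' i (restrict \<phi> (B' i)))"
      using aI bI rest by (subst split) (simp add: f'_def L2_set_def)
    finally show "(\<Sum>t\<in>N. \<Prod>i\<in>I. f i (restrict (\<phi>(v := t)) (B i))) \<le> (\<Prod>i\<in>I. f' i (restrict \<phi> (B' i)))" .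
  qed
  also have "\<dots> \<le> (\<Prod>i\<in>I. sqrt (\<Sum>\<psi>\<in>B' i \<rightarrow>\<^sub>E N. (f' i \<psi>)\<^sup>2))"
  proof (rule insert.IH)
    show "B' i \<subseteq> V" if "i \<in> I" for i using insert.prems(1)[OF that] by (auto simp: B'_def)
    show "card {i \<in> I. w \<in> B' i} = 2" if "w \<in> V" for w
    proof -
      have "w \<noteq> v" using that insert.hyps by auto
      then have "{i \<in> I. w \<in> B' i} = {i \<in> I. w \<in> B i}" by (auto simp: B'_def)
      then show ?thesis using insert.prems(2)[of w] that by simp
    qed
    show "0 \<le> f' i \<psi>" for i \<psi> using insert.prems(3) by (simp add: f'_def sum_nonneg)
  qed
  \<comment> \<open>Squaring \<open>f'\<close> restores the sum over the value at \<open>v\<close>,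
    so the right-hand side is the same for \<open>B'\<close>, \<open>f'\<close> as for
    \<open>B\<close>, \<open>f\<close>.\<close>
  also have "\<dots> = (\<Prod>i\<in>I. sqrt (\<Sum>\<psi>\<in>B i \<rightarrow>\<^sub>E N. (f i \<psi>)\<^sup>2))"
  proof (rule prod.cong[OF refl])
    fix i assume "i \<in> I"
    show "sqrt (\<Sum>\<psi>\<in>B' i \<rightarrow>\<^sub>E N. (f' i \<psi>)\<^sup>2) = sqrt (\<Sum>\<psi>\<in>B i \<rightarrow>\<^sub>E N. (f i \<psi>)\<^sup>2)"
    proof (cases "v \<in> B i")
      case True
      then have "B i = insert v (B' i)" "v \<notin> B' i" by (auto simp: B'_def)
      then show ?thesis using True by (simp add: sum_insert f'_def sum_nonneg)
    qed (simp add: B'_def f'_def)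
  qed
  finally show ?case .
qed

text \<open>The geometric mean of 1, ..., f grows with f: \<open>fact f\<close> is at most
  \<open>Suc f ^ f\<close>, while each of the \<open>l - f\<close> further factors of
  \<open>fact l\<close> is at least \<open>Suc f\<close>. In the exploration this charges the
  arrangements of f new points in proportion to f.\<close>

lemma fact_power_le:
  assumes "f \<le> l"
  shows "(fact f :: nat) ^ l \<le> fact l ^ f"
proof -
  have lower: "(fact f :: nat) \<le> Suc f ^ f"
    using fact_le_power[of f, where 'a = nat] power_mono[of f "Suc f" f] by simp
  have upper: "(fact f :: nat) * Suc f ^ k \<le> fact (f + k)" for k
  proof (induction k)
    case (Suc k)
    have "fact f * Suc f ^ Suc k = (fact f * Suc f ^ k) * Suc f" by (simp add: algebra_simps)
    also have "\<dots> \<le> fact (f + k) * Suc (f + k)" using Suc by (intro mult_mono) auto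
    finally show ?case by (simp add: mult.commute)
  qed simp
  have "(fact f :: nat) ^ l = fact f ^ f * fact f ^ (l - f)"
    using assms by (simp add: power_add[symmetric])
  also have "\<dots> \<le> fact f ^ f * (Suc f ^ f) ^ (l - f)"
    using lower by (intro mult_left_mono power_mono) auto
  also have "\<dots> = (fact f * Suc f ^ (l - f)) ^ f"
    by (simp only: power_mult_distrib power_mult[symmetric] mult.commute)
  also have "\<dots> \<le> fact l ^ f"
    using upper[of "l - f"] assms by (intro power_mono) auto
  finally show ?thesis .
qed

subsection \<open>Moments of Walsh sums\<close>

lemma borel_measurable_walsh [measurable]: "walsh S \<in> borel_measurable borel"
  unfolding walsh_def rademacher_def
  by (intro borel_measurable_prod borel_measurable_sgn measurable) simp

lemma abs_walsh_le: "\<bar>walsh S x\<bar> \<le> 1"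
  unfolding walsh_def abs_prod rademacher_def
  by (intro prod_le_1) (auto simp: sgn_if)

lemma set_integrable_bounded:
  fixes f :: "real \<Rightarrow> real"
  assumes [measurable]: "f \<in> borel_measurable borel" "S \<in> sets borel"
    and "emeasure lborel S < \<infinity>" and bound: "\<And>x. \<bar>f x\<bar> \<le> C"
  shows "set_integrable lborel S f"
  unfolding set_integrable_def
proof (rule Bochner_Integration.integrable_bound)
  show "integrable lborel (\<lambda>x. C * indicator S x :: real)"
    using assms by (intro integrable_mult_right) auto
  show "AE x in lborel. norm (indicat_real S x *\<^sub>R f x) \<le> norm (C * indicat_real S x)"
  proof (rule AE_I2)
    fix x
    have "\<bar>f x\<bar> \<le> \<bar>C\<bar>" using bound[of x] by linarith
    then show "norm (indicat_real S x *\<^sub>R f x) \<le> norm (C * indicat_real S x)"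
      by (simp add: indicator_def)
  qed
qed simp

text \<open>On each interval of length \<open>2 * h\<close> the second half cancels the
  first.\<close>

lemma integral_antiperiodic_eq_0:
  fixes f :: "real \<Rightarrow> real"
  assumes int: "\<And>a b. f integrable_on {a..b}" and "0 \<le> h" and anti: "\<And>x. f (x + h) = - f x"
  shows "integral {0..2 * real n * h} f = 0"
proof (induction n)
  case (Suc n)
  let ?c = "2 * real n * h"
  have "integral {?c..?c + h} f + integral {?c + h..?c + h + h} f = integral {?c..?c + h + h} f"
    using int \<open>0 \<le> h\<close> by (intro Henstock_Kurzweil_Integration.integral_combine) auto
  moreover have "integral {?c + h..?c + h + h} f = integral {?c..?c + h} (f \<circ> (+) h)"
    using integral_shift_Icc_real[of ?c "?c + h" f h] by simp
  moreover have "f \<circ> (+) h = (\<lambda>x. - f x)" using anti by (auto simp: add.commute)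
  ultimately have "integral {?c..?c + h + h} f = 0" by (simp add: o_def)
  moreover have "integral {0..?c} f + integral {?c..?c + h + h} f = integral {0..?c + h + h} f"
    using int \<open>0 \<le> h\<close> by (intro Henstock_Kurzweil_Integration.integral_combine) auto
  moreover have "?c + h + h = 2 * real (Suc n) * h" by (simp add: algebra_simps)
  ultimately show ?case using Suc by simp
qed simp

text \<open>With \<open>m = Min S\<close>, the function \<open>walsh S\<close> changes sign under translation by \<open>2 ^ (- m)\<close>:
  the factor \<open>rademacher m\<close> does, and the other factors have \<open>2 ^ (- m)\<close> as a period.\<close>

lemma LINT_walsh_eq_0:
  assumes "finite S" "0 \<notin> S" "S \<noteq> {}"
  shows "(LINT x:{0<..<1}|lborel. walsh S x) = 0"
proof -
  define m where "m = Min S"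
  define h :: real where "h = 1 / 2 ^ m"
  have m: "m \<in> S" and min: "\<And>k. k \<in> S \<Longrightarrow> m \<le> k" using assms by (auto simp: m_def)
  then have "m \<noteq> 0" using assms by metis
  have shift_m: "rademacher m (x + h) = - rademacher m x" for x
    by (simp add: rademacher_def h_def ring_distribs sgn_minus)
  have shift_k: "rademacher k (x + h) = rademacher k x" if "k \<in> S - {m}" for k x
  proof -
    have "m < k" using that min[of k] by auto
    then obtain d where d: "k = Suc (m + d)" by (auto simp: less_iff_Suc_add)
    have "2 ^ k * pi * (x + h) = 2 ^ k * pi * x + of_int (2 ^ d) * (2 * pi)"
      by (simp add: h_def d power_add field_simps)
    also have "sin \<dots> = sin (2 ^ k * pi * x)"
      using sin_cos_eq_iff[of "2 ^ k * pi * x + of_int (2 ^ d) * (2 * pi)" "2 ^ k * pi * x"]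
      by (metis mult.commute)
    finally show ?thesis by (simp add: rademacher_def)
  qed
  have walsh_split: "walsh S x = rademacher m x * (\<Prod>k\<in>S - {m}. rademacher k x)" for x
    unfolding walsh_def using prod.remove[OF assms(1) m] .
  have anti: "walsh S (x + h) = - walsh S x" for x
  proof -
    have "(\<Prod>k\<in>S - {m}. rademacher k (x + h)) = (\<Prod>k\<in>S - {m}. rademacher k x)"
      by (rule prod.cong[OF refl shift_k])
    then show ?thesis by (simp add: walsh_split shift_m)
  qed
  have "set_integrable lborel {a..b} (walsh S)" for a b
    by (intro set_integrable_bounded[of _ _ 1]) (auto simp: abs_walsh_le emeasure_lborel_Icc_eq)
  then have int: "walsh S integrable_on {a..b}" for a b
    using set_borel_integral_eq_integral(1) by blast
  \<comment> \<open>Since \<open>m\<close> is at least 1, the unit interval consists of exactly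
    \<open>2 ^ (m - 1)\<close> intervals of length \<open>2 * h\<close>.\<close>
  have period: "2 * real (2 ^ (m - 1)) * h = 1"
    using \<open>m \<noteq> 0\<close> by (cases m) (auto simp: h_def)
  have "(LINT x:{0<..<1}|lborel. walsh S x) = integral {0<..<1} (walsh S)"
    by (intro set_borel_integral_eq_integral set_integrable_bounded[of _ _ 1]) (auto simp: abs_walsh_le)
  also have "\<dots> = integral {0..2 * real (2 ^ (m - 1)) * h} (walsh S)"
    by (simp only: period integral_open_interval_real)
  also have "\<dots> = 0"
    by (rule integral_antiperiodic_eq_0[OF int _ anti]) (simp add: h_def)
  finally show ?thesis .
qed

text \<open>All zeros are dyadic rationals, hence countably many. Elsewhere the squares of the
  Rademacher functions are 1, which the value \<open>sgn 0 = 0\<close> would spoil.\<close>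

lemma AE_rademacher_nonzero: "AE x in lborel. \<forall>k. rademacher k x \<noteq> 0"
proof (subst AE_all_countable, rule allI)
  fix k :: nat
  have "{x. rademacher k x = 0} \<subseteq> range (\<lambda>i::int. of_int i / 2 ^ k)"
  proof
    fix x assume "x \<in> {x. rademacher k x = 0}"
    then have "sin (2 ^ k * pi * x) = 0" by (simp add: rademacher_def sgn_0_0)
    then obtain i :: int where "2 ^ k * pi * x = of_int i * pi" by (auto simp: sin_zero_iff_int2)
    then have "x = of_int i / 2 ^ k" by (simp add: field_simps)
    then show "x \<in> range (\<lambda>i::int. of_int i / 2 ^ k)" by blast
  qed
  then have "countable {x. rademacher k x = 0}"
    by (rule countable_subset) simp
  then have "{x. rademacher k x = 0} \<in> null_sets lborel"
    by (rule countable_imp_null_set_lborel)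
  then show "AE x in lborel. rademacher k x \<noteq> 0"
    by (rule AE_I') auto
qed

section \<open>Mixed moments and even covers\<close>

definition even_cover :: "'i set \<Rightarrow> ('i \<Rightarrow> 'v set) \<Rightarrow> bool" where
  "even_cover I A \<longleftrightarrow> (\<forall>v. even (card {i \<in> I. v \<in> A i}))"

text \<open>Almost everywhere the squares of Rademacher functions drop out of the product and leave
  the Walsh function of the set \<open>S\<close> of points covered an odd number of times. Its
  integral vanishes unless \<open>S\<close> is empty, which is the case of an even cover.\<close>

lemma LINT_prod_walsh:
  assumes I: "finite I" and A: "\<And>i. i \<in> I \<Longrightarrow> finite (A i)" "\<And>i. i \<in> I \<Longrightarrow> 0 \<notin> A i"
  shows "(LINT x:{0<..<1}|lborel. \<Prod>i\<in>I. walsh (A i) x) = (if even_cover I A then 1 else 0)"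
proof -
  define U where "U = (\<Union>i\<in>I. A i)"
  define S where "S = {k \<in> U. odd (card {i \<in> I. k \<in> A i})}"
  have U: "finite U" "0 \<notin> U" and S: "finite S" "0 \<notin> S" using I A by (auto simp: U_def S_def)
  have "(\<Prod>i\<in>I. walsh (A i) x) = walsh S x" if nz: "\<forall>k. rademacher k x \<noteq> 0" for x
  proof -
    have sq: "rademacher k x * rademacher k x = 1" for k
      using nz[rule_format, of k] by (auto simp: rademacher_def sgn_if split: if_splits)
    have pow: "rademacher k x ^ n = (if odd n then rademacher k x else 1)" for k n
      using sq by (induction n) auto
    have "(\<Prod>i\<in>I. walsh (A i) x) = (\<Prod>i\<in>I. \<Prod>k\<in>{k \<in> U. k \<in> A i}. rademacher k x)"
      unfolding walsh_def by (intro prod.cong) (auto simp: U_def)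
    also have "\<dots> = (\<Prod>k\<in>U. \<Prod>i\<in>{i \<in> I. k \<in> A i}. rademacher k x)"
      by (rule prod.swap_restrict[OF I U(1)])
    also have "\<dots> = (\<Prod>k\<in>U. if odd (card {i \<in> I. k \<in> A i}) then rademacher k x else 1)"
      by (simp add: pow)
    also have "\<dots> = walsh S x"
      unfolding S_def walsh_def by (rule prod.inter_filter[symmetric, OF U(1)])
    finally show ?thesis .
  qed
  then have "AE x in lborel. x \<in> {0<..<1} \<longrightarrow> (\<Prod>i\<in>I. walsh (A i) x) = walsh S x"
    using AE_rademacher_nonzero by (auto elim: eventually_mono)
  then have "(LINT x:{0<..<1}|lborel. \<Prod>i\<in>I. walsh (A i) x) = (LINT x:{0<..<1}|lborel. walsh S x)"
    by (intro set_lebesgue_integral_cong_AE) auto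
  also have "\<dots> = (if even_cover I A then 1 else 0)"
  proof (cases "S = {}")
    case True
    have "even (card {i \<in> I. k \<in> A i})" for k
    proof (cases "k \<in> U")
      case False
      then have "{i \<in> I. k \<in> A i} = {}" by (auto simp: U_def)
      then show ?thesis by (simp only: card.empty even_zero)
    qed (use True in \<open>auto simp: S_def\<close>)
    then show ?thesis
      using True by (simp add: walsh_def even_cover_def set_lebesgue_integral_def)
  next
    case False
    then show ?thesis
      using LINT_walsh_eq_0[OF S] by (auto simp: S_def even_cover_def)
  qed
  finally show ?thesis .
qed

text \<open>Expanding the power gives a sum over all p-tuples of sets, and each mixed moment in it
  is 0 or 1.\<close>

lemma LINT_walsh_sum_power:
  assumes F: "finite F" "\<And>A. A \<in> F \<Longrightarrow> finite A" "\<And>A. A \<in> F \<Longrightarrow> 0 \<notin> A"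
  shows "(LINT x:{0<..<1}|lborel. (\<Sum>A\<in>F. b A * walsh A x) ^ p)
    = (\<Sum>A\<in>{A \<in> {..<p} \<rightarrow>\<^sub>E F. even_cover {..<p} A}. \<Prod>i<p. b (A i))"
proof -
  let ?P = "{..<p} \<rightarrow>\<^sub>E F"
  have P: "finite ?P" using F(1) by (auto intro: finite_PiE)
  have expand: "(\<Sum>A\<in>F. b A * walsh A x) ^ p = (\<Sum>A\<in>?P. (\<Prod>i<p. b (A i)) * (\<Prod>i<p. walsh (A i) x))" for x
    using prod_sum_PiE[of "{..<p}" "\<lambda>_. F" "\<lambda>_ A. b A * walsh A x"] F(1)
    by (simp add: prod.distrib)
  have int: "set_integrable lborel {0<..<1} (\<lambda>x. \<Prod>i<p. walsh (A i) x)" for A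
    by (intro set_integrable_bounded[of _ _ 1])
       (auto simp: abs_prod intro!: prod_le_1 abs_walsh_le)
  have "(LINT x:{0<..<1}|lborel. (\<Sum>A\<in>F. b A * walsh A x) ^ p)
    = (LBINT x. \<Sum>A\<in>?P. (\<Prod>i<p. b (A i)) * (indicator {0<..<1} x *\<^sub>R (\<Prod>i<p. walsh (A i) x)))"
    unfolding expand by (simp add: set_lebesgue_integral_def sum_distrib_left mult.left_commute)
  also have "\<dots> = (\<Sum>A\<in>?P. (\<Prod>i<p. b (A i)) * (LINT x:{0<..<1}|lborel. \<Prod>i<p. walsh (A i) x))"
    using int by (subst Bochner_Integration.integral_sum)
      (auto simp: set_lebesgue_integral_def set_integrable_def)
  also have "\<dots> = (\<Sum>A\<in>?P. if even_cover {..<p} A then \<Prod>i<p. b (A i) else 0)"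
  proof (rule sum.cong[OF refl])
    fix A assume "A \<in> ?P"
    then have "A i \<in> F" if "i < p" for i using that by auto
    then show "(\<Prod>i<p. b (A i)) * (LINT x:{0<..<1}|lborel. \<Prod>i<p. walsh (A i) x)
      = (if even_cover {..<p} A then \<Prod>i<p. b (A i) else 0)"
      using F by (subst LINT_prod_walsh) auto
  qed
  also have "\<dots> = (\<Sum>A\<in>{A \<in> ?P. even_cover {..<p} A}. \<Prod>i<p. b (A i))"
    by (rule sum.inter_filter[symmetric, OF P])
  finally show ?thesis .
qed

lemma Lp_norm_chaos_sum:
  assumes "even p" "p \<ge> 1" "b \<in> finite_coeffs l"
  shows "Lp_norm (real p) (chaos_sum l b)
    = (\<Sum>A\<in>{A \<in> {..<p} \<rightarrow>\<^sub>E coeff_support l b. even_cover {..<p} A}. \<Prod>i<p. b (A i)) powr (1 / real p)"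
proof -
  \<comment> \<open>\<open>powr_realpow\<close> needs a positive base; at \<open>y = 0\<close> both
    sides are 0 because \<open>p\<close> is positive.\<close>
  have "\<bar>y\<bar> powr real p = y ^ p" for y :: real
    using assms(1,2) by (cases "y = 0") (auto simp: powr_realpow power_even_abs)
  then have "Lp_norm (real p) (chaos_sum l b)
    = (LINT x:{0<..<1}|lborel. (\<Sum>A\<in>coeff_support l b. b A * walsh A x) ^ p) powr (1 / real p)"
    by (simp add: Lp_norm_def chaos_sum_def)
  then show ?thesis
    using assms(3) by (subst (asm) LINT_walsh_sum_power)
      (auto simp: finite_coeffs_def coeff_support_def index_sets_def)
qed

text \<open>Single summands may be negative, but the sum is the integral of an even power.
  Monotonicity of \<open>powr\<close> needs this sign.\<close>

lemma sum_even_cover_nonneg: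
  fixes p :: nat
  assumes "even p" "b \<in> finite_coeffs l"
  shows "0 \<le> (\<Sum>A\<in>{A \<in> {..<p} \<rightarrow>\<^sub>E coeff_support l b. even_cover {..<p} A}. \<Prod>i<p. b (A i))"
proof -
  have "0 \<le> (LINT x:{0<..<1}|lborel. (\<Sum>A\<in>coeff_support l b. b A * walsh A x) ^ p)"
    using \<open>even p\<close> unfolding set_lebesgue_integral_def
    by (intro integral_nonneg_AE AE_I2) (auto simp: zero_le_even_power)
  then show ?thesis
    using assms(2) by (subst (asm) LINT_walsh_sum_power)
      (auto simp: finite_coeffs_def coeff_support_def index_sets_def)
qed

subsection \<open>E-classes of double coverings and the upper bound\<close>

text \<open>Tuples are what the moments count. The set-collection of a tuple forgets the order, and
  \<open>fam_mset_eqE\<close> recovers it up to a permutation of the indices.\<close>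

abbreviation fam_mset :: "nat \<Rightarrow> (nat \<Rightarrow> nat set) \<Rightarrow> nat set multiset" where
  "fam_mset p B \<equiv> image_mset B (mset_set {..<p})"

lemma fam_mset_cover:
  assumes "size \<A> = p"
  obtains B where "\<A> = fam_mset p B"
proof -
  obtain xs where xs: "mset xs = \<A>" using ex_mset by blast
  then have "length xs = p" using assms by auto
  then have "mset (map (nth xs) [0..<p]) = \<A>" using xs map_nth by metis
  then have "\<A> = fam_mset p (nth xs)"
    by (simp add: mset_map mset_upt lessThan_atLeast0)
  then show ?thesis using that by blast
qed

lemma set_mset_fam_mset [simp]: "set_mset (fam_mset p B) = B ` {..<p}"
  by simp

lemma size_filter_fam_mset: "size (filter_mset P (fam_mset p B)) = card {i \<in> {..<p}. P (B i)}"
  by (simp add: filter_mset_image_mset)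

lemma fam_mset_eqE:
  assumes "fam_mset p A = fam_mset p B"
  obtains \<sigma> where "\<sigma> permutes {..<p}" "\<And>i. i < p \<Longrightarrow> A i = B (\<sigma> i)"
  by (rule image_mset_eq_implies_permutes[OF finite_lessThan assms]) (simp add: that)

lemma fam_mset_permutes:
  assumes "\<sigma> permutes {..<p}"
  shows "fam_mset p (\<lambda>i. B (\<sigma> i)) = fam_mset p B"
proof -
  have "image_mset \<sigma> (mset_set {..<p}) = mset_set {..<p}"
    using permutes_image[OF assms] permutes_inj_on[OF assms] by (simp add: image_mset_mset_set)
  then have "image_mset B (image_mset \<sigma> (mset_set {..<p})) = fam_mset p B" by simp
  then show ?thesis by (simp add: multiset.map_comp o_def)
qed

lemma fam_mset_in_double_coverings:
  "fam_mset p B \<in> double_coverings l p \<longleftrightarrow> (\<forall>i<p. finite (B i) \<and> card (B i) = l)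
    \<and> (\<forall>v\<in>\<Union>i<p. B i. card {i \<in> {..<p}. v \<in> B i} = 2)"
  unfolding double_coverings_def double_covering_def set_collection_def
  by (auto simp: size_filter_fam_mset simp del: filter_mset_image_mset)

text \<open>Incidences of points and indices are counted in two ways.\<close>

lemma card_points_double_covering:
  assumes "fam_mset p B \<in> double_coverings l p"
  shows "2 * card (\<Union>i<p. B i) = l * p"
proof -
  let ?V = "\<Union>i<p. B i"
  have B: "\<And>i. i < p \<Longrightarrow> finite (B i) \<and> card (B i) = l"
    and two: "\<forall>v\<in>?V. card {i \<in> {..<p}. v \<in> B i} = 2"
    using assms by (auto simp: fam_mset_in_double_coverings)
  have "2 * card ?V = (\<Sum>i<p. card {v \<in> ?V. v \<in> B i})"
    using B two by (intro sum_multicount[symmetric]) auto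
  also have "\<dots> = (\<Sum>i<p. l)"
  proof (rule sum.cong[OF refl])
    fix i assume i: "i \<in> {..<p}"
    then have "{v \<in> ?V. v \<in> B i} = B i" by auto
    then show "card {v \<in> ?V. v \<in> B i} = l" using B i by simp
  qed
  finally show ?thesis by simp
qed

section \<open>E-classes as classes of an equivalence relation\<close>

lemma isomorphic_collections_map:
  assumes "inj_on \<phi> (\<Union>(set_mset \<A>))"
  shows "isomorphic_collections \<A> (image_mset ((`) \<phi>) \<A>)"
  using assms by (auto simp: isomorphic_collections_def bij_betw_def image_Union intro!: exI[of _ \<phi>])

lemma isomorphic_collections_sym:
  assumes "isomorphic_collections \<A> \<B>"
  shows "isomorphic_collections \<B> \<A>"
proof -
  obtain \<phi> where \<phi>: "bij_betw \<phi> (\<Union>(set_mset \<A>)) (\<Union>(set_mset \<B>))" "image_mset ((`) \<phi>) \<A> = \<B>"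
    using assms by (auto simp: isomorphic_collections_def)
  let ?\<psi> = "inv_into (\<Union>(set_mset \<A>)) \<phi>"
  have "?\<psi> ` \<phi> ` X = X" if "X \<in># \<A>" for X
    using \<phi>(1) that by (intro inv_into_image_cancel) (auto simp: bij_betw_def)
  then have "image_mset (\<lambda>X. ?\<psi> ` \<phi> ` X) \<A> = image_mset (\<lambda>X. X) \<A>"
    by (intro image_mset_cong)
  then have "image_mset ((`) ?\<psi>) \<B> = \<A>"
    by (simp add: \<phi>(2)[symmetric] multiset.map_comp o_def)
  then show ?thesis
    using bij_betw_inv_into[OF \<phi>(1)] unfolding isomorphic_collections_def by blast
qed

lemma isomorphic_collections_trans:
  assumes "isomorphic_collections \<A> \<B>" "isomorphic_collections \<B> \<C>"
  shows "isomorphic_collections \<A> \<C>"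
proof -
  obtain \<phi> \<psi> where "bij_betw \<phi> (\<Union>(set_mset \<A>)) (\<Union>(set_mset \<B>))" "image_mset ((`) \<phi>) \<A> = \<B>"
    "bij_betw \<psi> (\<Union>(set_mset \<B>)) (\<Union>(set_mset \<C>))" "image_mset ((`) \<psi>) \<B> = \<C>"
    using assms by (auto simp: isomorphic_collections_def)
  then show ?thesis
    unfolding isomorphic_collections_def
    by (intro exI[of _ "\<psi> \<circ> \<phi>"] conjI bij_betw_trans) (auto simp: multiset.map_comp o_def image_comp)
qed

lemma equiv_iso_rel: "equiv {\<A>. set_collection \<A>} iso_rel"
proof (rule equivI)
  have "isomorphic_collections \<A> \<A>" for \<A>
    using isomorphic_collections_map[of id \<A>] by (simp add: image_id id_def[symmetric])
  then show "refl_on {\<A>. set_collection \<A>} iso_rel"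
    by (auto simp: refl_on_def iso_rel_def)
  show "sym iso_rel"
    by (auto simp: sym_def iso_rel_def isomorphic_collections_sym)
  show "trans iso_rel"
    by (auto simp: trans_def iso_rel_def intro: isomorphic_collections_trans)
qed (auto simp: iso_rel_def)

lemma iso_rel_famE:
  assumes "(fam_mset p A, fam_mset p B) \<in> iso_rel"
  obtains \<phi> \<sigma> where "bij_betw \<phi> (\<Union>i<p. A i) (\<Union>i<p. B i)" "\<sigma> permutes {..<p}"
    "\<And>i. i < p \<Longrightarrow> B i = \<phi> ` A (\<sigma> i)"
proof -
  obtain \<phi> where \<phi>: "bij_betw \<phi> (\<Union>i<p. A i) (\<Union>i<p. B i)"
      "image_mset ((`) \<phi>) (fam_mset p A) = fam_mset p B"
    using assms by (auto simp: isomorphic_collections_def iso_rel_def)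
  then have "fam_mset p B = fam_mset p (\<lambda>i. \<phi> ` A i)" by (simp add: multiset.map_comp o_def)
  then show ?thesis by (rule fam_mset_eqE) (rule that[OF \<phi>(1)])
qed

lemma iso_rel_famI:
  assumes "\<And>i. i < p \<Longrightarrow> finite (A i)" "inj_on \<phi> (\<Union>i<p. A i)" "\<sigma> permutes {..<p}"
    "\<And>i. i < p \<Longrightarrow> B i = \<phi> ` A (\<sigma> i)"
  shows "(fam_mset p A, fam_mset p B) \<in> iso_rel"
proof -
  have "fam_mset p B = fam_mset p (\<lambda>i. \<phi> ` A (\<sigma> i))"
    using assms(4) by (intro image_mset_cong) auto
  also have "\<dots> = image_mset ((`) \<phi>) (fam_mset p A)"
    using fam_mset_permutes[OF assms(3), of "\<lambda>i. \<phi> ` A i"] by (simp add: multiset.map_comp o_def)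
  finally have eq: "fam_mset p B = image_mset ((`) \<phi>) (fam_mset p A)" .
  have "isomorphic_collections (fam_mset p A) (fam_mset p B)"
    unfolding eq using assms(2) by (intro isomorphic_collections_map) simp
  moreover have "set_collection (fam_mset p A)" using assms(1) by (auto simp: set_collection_def)
  moreover have "set_collection (fam_mset p B)"
    unfolding eq using assms(1) by (auto simp: set_collection_def)
  ultimately show ?thesis by (simp add: iso_rel_def)
qed

lemma double_coverings_subset: "double_coverings l p \<subseteq> {\<A>. set_collection \<A>}"
  by (auto simp: double_coverings_def double_covering_def)

text \<open>The number of points is bounded by \<open>l * p\<close>, so every double covering can be
  relabelled inside \<open>{..<l * p}\<close>, where only finitely many collections exist. As an
  infinite set has \<open>card\<close> 0, this is what gives \<open>mu_full\<close> and
  \<open>mu_standard\<close> their meaning.\<close>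

lemma finite_double_covering_classes: "finite (double_coverings l p // iso_rel)"
proof -
  let ?M = "multisets_of_size (Pow {..<l * p}) p"
  have "double_coverings l p // iso_rel \<subseteq> (\<lambda>\<A>. iso_rel `` {\<A>}) ` ?M"
  proof
    fix q assume "q \<in> double_coverings l p // iso_rel"
    then obtain \<A> where \<A>: "\<A> \<in> double_coverings l p" "q = iso_rel `` {\<A>}" by (auto elim: quotientE)
    then have "size \<A> = p" by (simp add: double_coverings_def)
    then obtain B where B: "\<A> = fam_mset p B" using fam_mset_cover by blast
    then have fin: "\<And>i. i < p \<Longrightarrow> finite (B i)"
      using \<A>(1) by (auto simp: fam_mset_in_double_coverings)
    have "card (\<Union>i<p. B i) \<le> card {..<l * p}"
      using card_points_double_covering[where p = p and B = B and l = l] \<A>(1) B by simp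
    then obtain \<phi> where \<phi>: "inj_on \<phi> (\<Union>i<p. B i)" "\<phi> ` (\<Union>i<p. B i) \<subseteq> {..<l * p}"
      using card_le_inj[of "\<Union>i<p. B i" "{..<l * p}"] fin by auto
    let ?\<B> = "fam_mset p (\<lambda>i. \<phi> ` B i)"
    have "(\<A>, ?\<B>) \<in> iso_rel"
      unfolding B by (rule iso_rel_famI[OF fin \<phi>(1) permutes_id]) auto
    then have "q = iso_rel `` {?\<B>}" using \<A>(2) equiv_class_eq[OF equiv_iso_rel] by simp
    moreover have "?\<B> \<in> ?M" using \<phi>(2) by (auto simp: multisets_of_size_def)
    ultimately show "q \<in> (\<lambda>\<A>. iso_rel `` {\<A>}) ` ?M" by blast
  qed
  then show ?thesis by (rule finite_subset) auto
qed

text \<open>\<open>D\<close> is taken both as all double coverings and as the standard ones; in the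
  second case the chosen representative is itself standard.\<close>

lemma class_representatives:
  assumes "D \<subseteq> double_coverings l p"
  obtains rep where "\<And>q. q \<in> D // iso_rel \<Longrightarrow> fam_mset p (rep q) \<in> D"
    "\<And>q. q \<in> D // iso_rel \<Longrightarrow> q = iso_rel `` {fam_mset p (rep q)}"
proof -
  have "\<exists>B. fam_mset p B \<in> D \<and> q = iso_rel `` {fam_mset p B}" if "q \<in> D // iso_rel" for q
  proof -
    obtain \<A> where \<A>: "\<A> \<in> D" "q = iso_rel `` {\<A>}" using \<open>q \<in> D // iso_rel\<close> by (auto elim: quotientE)
    then have "size \<A> = p" using assms by (auto simp: double_coverings_def)
    then obtain B where "\<A> = fam_mset p B" using fam_mset_cover by blast
    then show ?thesis using \<A> by blast
  qed
  then show ?thesis using that by metis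
qed

text \<open>Splitting every point of an even cover into as many copies as there are pairs of sets
  containing it turns the cover into a double covering.\<close>

lemma even_cover_image_of_double_covering:
  fixes A :: "nat \<Rightarrow> nat set"
  assumes A: "\<And>i. i < p \<Longrightarrow> finite (A i) \<and> card (A i) = l" and even: "even_cover {..<p} A"
  obtains B \<phi> where "fam_mset p B \<in> double_coverings l p" "\<And>i. i < p \<Longrightarrow> \<phi> ` B i = A i"
proof -
  let ?I = "\<lambda>v. {i \<in> {..<p}. v \<in> A i}"
  have "\<forall>v. \<exists>g :: nat \<Rightarrow> nat. \<forall>i\<in>?I v. card {j \<in> ?I v. g j = g i} = 2"
  proof
    fix v
    have "even (card {i \<in> {..<p}. v \<in> A i})" using even by (simp add: even_cover_def)
    then obtain g :: "nat \<Rightarrow> nat" where "\<And>i. i \<in> ?I v \<Longrightarrow> card {j \<in> ?I v. g j = g i} = 2"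
      by (rule even_card_pairing[rotated]) auto
    then show "\<exists>g :: nat \<Rightarrow> nat. \<forall>i\<in>?I v. card {j \<in> ?I v. g j = g i} = 2" by blast
  qed
  from choice[OF this] obtain g :: "nat \<Rightarrow> nat \<Rightarrow> nat" where
    g: "\<forall>v. \<forall>i\<in>?I v. card {j \<in> ?I v. g v j = g v i} = 2" by blast
  \<comment> \<open>The copy of \<open>v\<close> in the set with index \<open>i\<close> is
    \<open>v\<close> together with the label of the pair of \<open>i\<close>, coded by
    \<open>prod_encode\<close> as a natural number. The first projection folds the copies
    back.\<close>
  define B where "B i = (\<lambda>v. prod_encode (v, g v i)) ` A i" for i
  let ?\<phi> = "\<lambda>x. fst (prod_decode x)"
  have img: "?\<phi> ` B i = A i" for i by (force simp: B_def)
  have "inj_on (\<lambda>v. prod_encode (v, g v i)) (A i)" for i by (auto simp: inj_on_def)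
  then have "finite (B i) \<and> card (B i) = l" if "i < p" for i
    using A[OF that] by (simp add: B_def card_image)
  moreover have "card {j \<in> {..<p}. x \<in> B j} = 2" if x: "x \<in> (\<Union>i<p. B i)" for x
  proof -
    obtain i v where iv: "i < p" "v \<in> A i" "x = prod_encode (v, g v i)" using x by (auto simp: B_def)
    then have "{j \<in> {..<p}. x \<in> B j} = {j \<in> ?I v. g v j = g v i}"
      by (force simp: B_def)
    moreover have "card {j \<in> ?I v. g v j = g v i} = 2" using iv by (intro g[rule_format]) simp
    ultimately show ?thesis by (simp only:)
  qed
  ultimately have "fam_mset p B \<in> double_coverings l p"
    by (auto simp: fam_mset_in_double_coverings)
  then show ?thesis using that[of B ?\<phi>] img by blast
qed

text \<open>The maps are grouped by their image. A map of \<open>X\<close> onto a set of the same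
  size is a bijection, so each \<open>A\<close> is reached by at most \<open>fact (card X)\<close>
  maps.\<close>

lemma sum_image_sets_le:
  fixes c :: "'a set \<Rightarrow> real"
  assumes "finite X" "finite N" "finite F" and F: "\<And>A. A \<in> F \<Longrightarrow> card A = card X"
  shows "(\<Sum>\<psi>\<in>X \<rightarrow>\<^sub>E N. (if \<psi> ` X \<in> F then c (\<psi> ` X) else 0)\<^sup>2) \<le> fact (card X) * (\<Sum>A\<in>F. (c A)\<^sup>2)"
proof -
  let ?P = "X \<rightarrow>\<^sub>E N"
  have P: "finite ?P" using assms by (auto intro: finite_PiE)
  have "(\<Sum>\<psi>\<in>?P. (if \<psi> ` X \<in> F then c (\<psi> ` X) else 0)\<^sup>2)
      = (\<Sum>\<psi>\<in>?P. if \<psi> ` X \<in> F then (c (\<psi> ` X))\<^sup>2 else 0)"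
    by (intro sum.cong) auto
  also have "\<dots> = (\<Sum>\<psi>\<in>{\<psi> \<in> ?P. \<psi> ` X \<in> F}. (c (\<psi> ` X))\<^sup>2)"
    by (rule sum.inter_filter[symmetric, OF P])
  also have "\<dots> = (\<Sum>A\<in>F. \<Sum>\<psi>\<in>{\<psi> \<in> {\<psi> \<in> ?P. \<psi> ` X \<in> F}. \<psi> ` X = A}. (c (\<psi> ` X))\<^sup>2)"
    using P assms(3) by (intro sum.group[symmetric]) auto
  also have "\<dots> = (\<Sum>A\<in>F. real (card {\<psi> \<in> ?P. \<psi> ` X = A}) * (c A)\<^sup>2)"
  proof (rule sum.cong[OF refl])
    fix A assume "A \<in> F"
    then have "{\<psi> \<in> {\<psi> \<in> ?P. \<psi> ` X \<in> F}. \<psi> ` X = A} = {\<psi> \<in> ?P. \<psi> ` X = A}" by auto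
    then show "(\<Sum>\<psi>\<in>{\<psi> \<in> {\<psi> \<in> ?P. \<psi> ` X \<in> F}. \<psi> ` X = A}. (c (\<psi> ` X))\<^sup>2)
      = real (card {\<psi> \<in> ?P. \<psi> ` X = A}) * (c A)\<^sup>2" by simp
  qed
  also have "\<dots> \<le> (\<Sum>A\<in>F. fact (card X) * (c A)\<^sup>2)"
  proof (intro sum_mono mult_right_mono)
    fix A assume A: "A \<in> F"
    have "{\<psi> \<in> ?P. \<psi> ` X = A} \<subseteq> {\<psi> \<in> X \<rightarrow>\<^sub>E A. bij_betw \<psi> X A}"
      using F[OF A] assms(1) by (auto simp: bij_betw_def intro: eq_card_imp_inj_on)
    moreover have "finite {\<psi> \<in> X \<rightarrow>\<^sub>E A. bij_betw \<psi> X A}"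
    proof (cases "finite A")
      case True
      then show ?thesis using assms(1) by (intro finite_subset[OF _ finite_PiE[of X "\<lambda>_. A"]]) auto
    next
      \<comment> \<open>An infinite \<open>A\<close> has \<open>card\<close> 0 and so satisfies the
        size condition when \<open>X\<close> is empty.\<close>
      case False
      then have "{\<psi> \<in> X \<rightarrow>\<^sub>E A. bij_betw \<psi> X A} = {}" using assms(1) bij_betw_finite by auto
      then show ?thesis by (simp only: finite.emptyI)
    qed
    ultimately have "card {\<psi> \<in> ?P. \<psi> ` X = A} \<le> fact (card X)"
      using card_mono[of "{\<psi> \<in> X \<rightarrow>\<^sub>E A. bij_betw \<psi> X A}" "{\<psi> \<in> ?P. \<psi> ` X = A}"]
        card_bijections_le[OF assms(1), of A] by linarith
    then have "real (card {\<psi> \<in> ?P. \<psi> ` X = A}) \<le> real (fact (card X))"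
      by (simp only: of_nat_le_iff)
    then show "real (card {\<psi> \<in> ?P. \<psi> ` X = A}) \<le> fact (card X)"
      by (simp only: of_nat_fact)
  qed simp
  finally show ?thesis by (simp add: sum_distrib_left)
qed

lemma sum_even_cover_le:
  assumes b: "b \<in> finite_coeffs l" "coeff_norm l b \<le> 1"
  shows "(\<Sum>A\<in>{A \<in> {..<p} \<rightarrow>\<^sub>E coeff_support l b. even_cover {..<p} A}. \<Prod>i<p. b (A i))
    \<le> sqrt (fact l) ^ p * (fact p * real (mu_full l p))"
proof -
  define F where "F = coeff_support l b"
  define N where "N = \<Union>F"
  define E where "E = {A \<in> {..<p} \<rightarrow>\<^sub>E F. even_cover {..<p} A}"
  define Q where "Q = double_coverings l p // iso_rel"
  define S where "S = {\<sigma>. \<sigma> permutes {..<p}}"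
  \<comment> \<open>Absolute values allow overcounting, and the extension by 0 allows maps that send
    a block to a set outside \<open>F\<close>.\<close>
  define c where "c A = (if A \<in> F then \<bar>b A\<bar> else 0)" for A
  have F: "finite F" "\<And>A. A \<in> F \<Longrightarrow> finite A \<and> card A = l"
    using b(1) by (auto simp: F_def finite_coeffs_def coeff_support_def index_sets_def)
  then have N: "finite N" by (auto simp: N_def)
  have c0: "c A \<ge> 0" for A by (simp add: c_def)
  have b_le: "(\<Sum>A\<in>F. \<bar>b A\<bar>\<^sup>2) \<le> 1"
    using b(2) by (simp add: coeff_norm_def F_def)
  obtain rep where rep: "\<And>q. q \<in> Q \<Longrightarrow> fam_mset p (rep q) \<in> double_coverings l p"
      "\<And>q. q \<in> Q \<Longrightarrow> q = iso_rel `` {fam_mset p (rep q)}"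
    unfolding Q_def using class_representatives[OF order_refl] by metis
  define V where "V q = (\<Union>i<p. rep q i)" for q
  have rep_sets: "finite (rep q i)" "card (rep q i) = l" if "q \<in> Q" "i < p" for q i
    using rep(1)[OF that(1)] that(2) by (auto simp: fam_mset_in_double_coverings)
  then have V: "finite (V q)" if "q \<in> Q" for q using that by (auto simp: V_def)
  have fin_maps: "finite (V q \<rightarrow>\<^sub>E N)" if "q \<in> Q" for q
    using V[OF that] N by (auto intro: finite_PiE)
  have Q: "finite Q" unfolding Q_def by (rule finite_double_covering_classes)
  have S: "finite S" "card S = fact p" unfolding S_def using card_permutations[of "{..<p}" p]
    by (auto simp: finite_permutations)
  \<comment> \<open>A triple is an E-class, an order of the blocks of its representative, and a map
    of its points. For an upper bound it suffices that every tuple in \<open>E\<close> arises at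
    least once.\<close>
  define T where "T = Sigma Q (\<lambda>q. S \<times> (V q \<rightarrow>\<^sub>E N))"
  define tup where "tup = (\<lambda>(q, \<sigma>, \<phi> :: nat \<Rightarrow> nat). \<lambda>i\<in>{..<p}. \<phi> ` rep q (\<sigma> i))"
  have T: "finite T" unfolding T_def using Q S fin_maps by auto
  have cover: "E \<subseteq> tup ` T"
  proof
    fix A assume "A \<in> E"
    then have A: "A \<in> {..<p} \<rightarrow>\<^sub>E F" "even_cover {..<p} A" by (auto simp: E_def)
    then have "\<And>i. i < p \<Longrightarrow> finite (A i) \<and> card (A i) = l" using F(2) by auto
    then obtain B \<theta> where B: "fam_mset p B \<in> double_coverings l p" "\<And>i. i < p \<Longrightarrow> \<theta> ` B i = A i"
      using even_cover_image_of_double_covering A(2) by metis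
    define q where "q = iso_rel `` {fam_mset p B}"
    have q: "q \<in> Q" unfolding Q_def q_def using B(1) by (rule quotientI)
    have "fam_mset p B \<in> q"
      unfolding q_def using equiv_class_self[OF equiv_iso_rel] B(1) double_coverings_subset by blast
    then have "(fam_mset p (rep q), fam_mset p B) \<in> iso_rel" using rep(2)[OF q] by blast
    then obtain \<psi> \<sigma> where \<psi>: "\<sigma> permutes {..<p}" "\<And>i. i < p \<Longrightarrow> B i = \<psi> ` rep q (\<sigma> i)"
      by (rule iso_rel_famE) (rule that)
    \<comment> \<open>First relabel the representative as \<open>B\<close>, then fold the copies of
      each point together.\<close>
    define \<phi> where "\<phi> = restrict (\<theta> \<circ> \<psi>) (V q)"
    have A_eq: "A i = \<phi> ` rep q (\<sigma> i)" if "i < p" for i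
    proof -
      have "\<sigma> i < p" using permutes_in_image[OF \<psi>(1), of i] that by simp
      then have "rep q (\<sigma> i) \<subseteq> V q" by (auto simp: V_def)
      then have "\<phi> ` rep q (\<sigma> i) = (\<theta> \<circ> \<psi>) ` rep q (\<sigma> i)"
        by (intro image_cong) (auto simp: \<phi>_def)
      then show ?thesis using B(2)[OF that] \<psi>(2)[OF that] by (simp add: image_comp)
    qed
    have "\<phi> v \<in> N" if v: "v \<in> V q" for v
    proof -
      obtain j where j: "j < p" "v \<in> rep q j" using v by (auto simp: V_def)
      obtain i where i: "i < p" "j = \<sigma> i"
        using permutes_image[OF \<psi>(1)] j(1) by (metis imageE lessThan_iff)
      have "A i \<in> F" using A(1) i(1) by auto
      then show ?thesis using A_eq[OF i(1)] j(2) i(2) by (auto simp: N_def)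
    qed
    then have "\<phi> \<in> V q \<rightarrow>\<^sub>E N" by (auto simp: \<phi>_def)
    moreover have "A = tup (q, \<sigma>, \<phi>)"
      using A(1) A_eq by (auto simp: tup_def PiE_def extensional_def fun_eq_iff)
    ultimately show "A \<in> tup ` T" using q \<psi>(1) by (auto simp: T_def S_def)
  qed
  \<comment> \<open>The weight of a block depends only on the restriction of the map to that block,
    so the Cauchy--Schwarz bound for double coverings applies, with one factor
    \<open>sqrt (fact l)\<close> for each index.\<close>
  have hoelder: "(\<Sum>\<phi>\<in>V q \<rightarrow>\<^sub>E N. \<Prod>i<p. c (\<phi> ` rep q i)) \<le> sqrt (fact l) ^ p" if q: "q \<in> Q" for q
  proof -
    have two: "card {i \<in> {..<p}. v \<in> rep q i} = 2" if "v \<in> V q" for v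
      using rep(1)[OF q] that by (auto simp: fam_mset_in_double_coverings V_def)
    have "(\<Sum>\<phi>\<in>V q \<rightarrow>\<^sub>E N. \<Prod>i<p. c (\<phi> ` rep q i))
      = (\<Sum>\<phi>\<in>V q \<rightarrow>\<^sub>E N. \<Prod>i<p. c (restrict \<phi> (rep q i) ` rep q i))" by simp
    also have "\<dots> \<le> (\<Prod>i<p. sqrt (\<Sum>\<psi>\<in>rep q i \<rightarrow>\<^sub>E N. (c (\<psi> ` rep q i))\<^sup>2))"
      using V[OF q] N two c0
      by (intro sum_prod_double_cover_le[where f = "\<lambda>i \<psi>. c (\<psi> ` rep q i)"]) (auto simp: V_def)
    also have "\<dots> \<le> (\<Prod>i<p. sqrt (fact l))"
    proof (rule prod_mono, intro conjI real_sqrt_le_mono)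
      fix i assume "i \<in> {..<p}"
      then have r: "finite (rep q i)" "card (rep q i) = l" using rep_sets[OF q] by auto
      have "(\<Sum>\<psi>\<in>rep q i \<rightarrow>\<^sub>E N. (c (\<psi> ` rep q i))\<^sup>2) \<le> fact l * (\<Sum>A\<in>F. \<bar>b A\<bar>\<^sup>2)"
        using sum_image_sets_le[OF r(1) N F(1), of "\<lambda>A. \<bar>b A\<bar>"] F(2) r(2) by (simp add: c_def)
      also have "\<dots> \<le> fact l" using b_le mult_left_mono[OF b_le, of "fact l"] by simp
      finally show "(\<Sum>\<psi>\<in>rep q i \<rightarrow>\<^sub>E N. (c (\<psi> ` rep q i))\<^sup>2) \<le> fact l" .
    qed (simp add: sum_nonneg)
    finally show ?thesis by simp
  qed
  have "(\<Sum>A\<in>E. \<Prod>i<p. b (A i)) \<le> (\<Sum>A\<in>E. \<Prod>i<p. c (A i))"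
  proof (rule sum_mono)
    fix A assume "A \<in> E"
    then have "c (A i) = \<bar>b (A i)\<bar>" if "i < p" for i using that by (auto simp: E_def c_def)
    then have "(\<Prod>i<p. c (A i)) = \<bar>\<Prod>i<p. b (A i)\<bar>" by (simp add: abs_prod)
    then show "(\<Prod>i<p. b (A i)) \<le> (\<Prod>i<p. c (A i))" by simp
  qed
  also have "\<dots> \<le> (\<Sum>A\<in>tup ` T. \<Prod>i<p. c (A i))"
    using T cover c0 by (intro sum_mono2) (auto intro: prod_nonneg)
  also have "\<dots> \<le> (\<Sum>t\<in>T. \<Prod>i<p. c (tup t i))"
    using sum_image_le[OF T, of "\<lambda>A. \<Prod>i<p. c (A i)" tup] c0 by (simp add: prod_nonneg o_def)
  also have "\<dots> = (\<Sum>(q, \<sigma>, \<phi>)\<in>T. \<Prod>i<p. c (\<phi> ` rep q (\<sigma> i)))"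
    by (intro sum.cong) (auto simp: tup_def)
  also have "\<dots> = (\<Sum>q\<in>Q. \<Sum>(\<sigma>, \<phi>)\<in>S \<times> (V q \<rightarrow>\<^sub>E N). \<Prod>i<p. c (\<phi> ` rep q (\<sigma> i)))"
    unfolding T_def using Q S fin_maps by (subst sum.Sigma) auto
  also have "\<dots> = (\<Sum>q\<in>Q. \<Sum>\<sigma>\<in>S. \<Sum>\<phi>\<in>V q \<rightarrow>\<^sub>E N. \<Prod>i<p. c (\<phi> ` rep q (\<sigma> i)))"
    by (simp only: sum.cartesian_product)
  \<comment> \<open>Permuting the indices only reorders the factors, so each E-class enters with
    multiplicity \<open>fact p\<close>.\<close>
  also have "\<dots> = (\<Sum>q\<in>Q. \<Sum>\<sigma>\<in>S. \<Sum>\<phi>\<in>V q \<rightarrow>\<^sub>E N. \<Prod>i<p. c (\<phi> ` rep q i))"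
  proof (intro sum.cong refl)
    fix q \<sigma> \<phi> assume "\<sigma> \<in> S"
    then show "(\<Prod>i<p. c (\<phi> ` rep q (\<sigma> i))) = (\<Prod>i<p. c (\<phi> ` rep q i))"
      using prod.permute[of \<sigma> "{..<p}" "\<lambda>i. c (\<phi> ` rep q i)"] by (simp add: S_def o_def)
  qed
  also have "\<dots> \<le> (\<Sum>q\<in>Q. \<Sum>\<sigma>\<in>S. sqrt (fact l) ^ p)"
    using hoelder by (intro sum_mono)
  also have "\<dots> = sqrt (fact l) ^ p * (fact p * real (mu_full l p))"
    by (simp add: S(2) mu_full_def Q_def)
  finally show ?thesis by (simp add: E_def F_def)
qed

subsection \<open>Automorphisms of standard double coverings\<close>

text \<open>Positive \<open>l\<close> makes all blocks nonempty, so indices carrying equal blocks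
  are adjacent in the intersection graph.\<close>

locale double_cover =
  fixes p l :: nat and B :: "nat \<Rightarrow> nat set"
  assumes cover: "fam_mset p B \<in> double_coverings l p" and l_pos: "l > 0"
begin

definition points :: "nat set" where "points = (\<Union>i<p. B i)"

text \<open>The index permutation is recorded along with the point map because equal blocks can be
  exchanged without moving any point. Point maps are extensional, so that each is counted
  once.\<close>

definition automorphisms :: "((nat \<Rightarrow> nat) \<times> (nat \<Rightarrow> nat)) set" where
  "automorphisms = {(\<rho>, \<pi>). \<rho> permutes {..<p} \<and> \<pi> \<in> points \<rightarrow>\<^sub>E points \<and> bij_betw \<pi> points points
    \<and> (\<forall>i<p. \<pi> ` B i = B (\<rho> i))}"

section \<open>Connected components on the level of indices\<close>

definition adj :: "(nat \<times> nat) set" where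
  "adj = {(i, j). i < p \<and> j < p \<and> B i \<inter> B j \<noteq> {}}"

definition component :: "nat \<Rightarrow> nat set" where
  "component i = adj\<^sup>* `` {i}"

lemma finite_block: "i < p \<Longrightarrow> finite (B i)"
  and card_block: "i < p \<Longrightarrow> card (B i) = l"
  and card_containing: "v \<in> points \<Longrightarrow> card {i \<in> {..<p}. v \<in> B i} = 2"
  using cover by (auto simp: fam_mset_in_double_coverings points_def)

lemma block_nonempty: "i < p \<Longrightarrow> B i \<noteq> {}"
  using card_block l_pos by fastforce

lemma finite_points: "finite points"
  by (auto simp: points_def finite_block)

lemma sym_adj: "(i, j) \<in> adj \<Longrightarrow> (j, i) \<in> adj"
  by (auto simp: adj_def)

lemma component_self: "i \<in> component i"
  by (simp add: component_def)

lemma component_subset: "i < p \<Longrightarrow> component i \<subseteq> {..<p}"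
proof
  fix j assume i: "i < p" and "j \<in> component i"
  then have "(i, j) \<in> adj\<^sup>*" by (simp add: component_def)
  then show "j \<in> {..<p}" using i by (induction) (auto simp: adj_def)
qed

lemma component_step: "j \<in> component i \<Longrightarrow> (j, k) \<in> adj \<Longrightarrow> k \<in> component i"
  by (auto simp: component_def)

lemma component_eq:
  assumes "j \<in> component i"
  shows "component j = component i"
proof -
  have "sym adj" by (simp add: symI sym_adj)
  then have "(i, j) \<in> adj\<^sup>*" "(j, i) \<in> adj\<^sup>*"
    using assms sym_rtrancl[of adj] by (auto simp: component_def dest: symD)
  then show ?thesis unfolding component_def by (auto intro: rtrancl_trans)
qed

lemma count_component_mset:
  assumes "S \<subseteq> {..<p}"
  shows "count (image_mset B (mset_set S)) X = card {j \<in> S. B j = X}"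
proof -
  have "finite S" using assms finite_subset by blast
  then show ?thesis
    by (simp add: count_image_mset' Collect_conj_eq Int_commute eq_commute)
qed

text \<open>For maximality, a connected collection that contains this one can only hold blocks
  reachable from \<open>B i\<close>, and all copies of such a block are already in it.\<close>

lemma connected_component_component:
  assumes i: "i < p"
  shows "connected_component_of_collection (fam_mset p B) (image_mset B (mset_set (component i)))"
proof -
  let ?C = "image_mset B (mset_set (component i))"
  have sub: "component i \<subseteq> {..<p}" using component_subset[OF i] .
  have fin: "finite (component i)" using sub finite_subset by blast
  have le: "?C \<subseteq># fam_mset p B"
    using sub by (intro image_mset_subseteq_mono subset_imp_msubset_mset_set) auto
  have conn: "connected_collection ?C"
    unfolding connected_collection_def
  proof (intro allI impI, elim conjE)
    fix X Y assume "X \<in># ?C" "Y \<in># ?C"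
    then obtain a b where ab: "a \<in> component i" "b \<in> component i" "X = B a" "Y = B b"
      using fin by auto
    then have "(a, b) \<in> adj\<^sup>*" using component_eq[of a i] by (auto simp: component_def)
    then obtain n f where f: "f 0 = a" "f n = b" "\<forall>j<n. (f j, f (Suc j)) \<in> adj"
      by (auto dest!: rtrancl_imp_relpow simp: relpow_fun_conv)
    have mem: "f j \<in> component i" if "j \<le> n" for j
      using that
    proof (induction j)
      case (Suc j)
      then show ?case using f(3) component_step[of "f j" i "f (Suc j)"] by simp
    qed (simp add: f(1) ab(1))
    show "\<exists>E m. E 0 = X \<and> E m = Y \<and> (\<forall>j\<le>m. E j \<in># ?C) \<and> (\<forall>j<m. E j \<inter> E (Suc j) \<noteq> {})"
      using f ab mem fin by (intro exI[of _ "\<lambda>j. B (f j)"] exI[of _ n]) (auto simp: adj_def)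
  qed
  have "\<D> = ?C" if D: "?C \<subseteq># \<D>" "\<D> \<subseteq># fam_mset p B" "connected_collection \<D>" for \<D>
  proof (rule subset_mset.antisym[OF _ D(1)])
    have in_D: "\<exists>k<p. Z = B k" if "Z \<in># \<D>" for Z
      using mset_subset_eqD[OF D(2) that] by auto
    have reach: "\<exists>k\<in>component i. X = B k" if X: "X \<in># \<D>" for X
    proof (cases "X = B i")
      case False
      have "B i \<in># \<D>" using D(1) fin component_self by (auto elim!: mset_subset_eqD)
      then obtain E m where E: "E 0 = B i" "E m = X" "\<forall>j\<le>m. E j \<in># \<D>"
          "\<forall>j<m. E j \<inter> E (Suc j) \<noteq> {}"
        using D(3) X False unfolding connected_collection_def by metis
      have "\<exists>k\<in>component i. E j = B k" if "j \<le> m" for j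
        using that
      proof (induction j)
        case (Suc j)
        then obtain k where k: "k \<in> component i" "E j = B k" by auto
        obtain k' where k': "k' < p" "E (Suc j) = B k'" using E(3) in_D Suc.prems by blast
        have "E j \<inter> E (Suc j) \<noteq> {}" using E(4) Suc.prems by auto
        then have "(k, k') \<in> adj" using k k' sub by (auto simp: adj_def)
        then show ?case using component_step k(1) k'(2) by blast
      qed (use E(1) component_self in auto)
      then show ?thesis using E(2) by blast
    qed (use component_self in auto)
    show "\<D> \<subseteq># ?C"
    proof (rule mset_subset_eqI)
      fix X
      show "count \<D> X \<le> count ?C X"
      proof (cases "X \<in># \<D>")
        case True
        then obtain k where k: "k \<in> component i" "X = B k" using reach by blast
        \<comment> \<open>Blocks are nonempty, so every index carrying \<open>X\<close> is adjacent
          to \<open>k\<close> and lies in the same component.\<close>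
        then have "{j \<in> {..<p}. B j = X} \<subseteq> {j \<in> component i. B j = X}"
          using sub block_nonempty component_step[OF k(1)] by (auto simp: adj_def)
        then have "card {j \<in> {..<p}. B j = X} \<le> card {j \<in> component i. B j = X}"
          using fin by (intro card_mono) auto
        then have "count (fam_mset p B) X \<le> count ?C X"
          unfolding count_component_mset[OF sub] count_component_mset[OF order_refl] .
        then show ?thesis using mset_subset_eq_count[OF D(2), of X] by simp
      qed (simp add: not_in_iff)
    qed
  qed
  moreover have "?C \<noteq> {#}" using fin component_self[of i] by (auto simp: mset_set_empty_iff)
  ultimately show ?thesis
    unfolding connected_component_of_collection_def using le conn by blast
qed

lemma automorphismD:
  assumes "(\<rho>, \<pi>) \<in> automorphisms"
  shows "\<rho> permutes {..<p}" "\<pi> \<in> points \<rightarrow>\<^sub>E points" "inj_on \<pi> points"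
    "\<And>i. i < p \<Longrightarrow> \<pi> ` B i = B (\<rho> i)" "\<And>i. \<rho> i < p \<longleftrightarrow> i < p"
  using assms permutes_in_image[of \<rho> "{..<p}"] by (auto simp: automorphisms_def bij_betw_def)

lemma block_subset_points: "i < p \<Longrightarrow> B i \<subseteq> points"
  by (auto simp: points_def)

lemma automorphism_adj:
  assumes aut: "(\<rho>, \<pi>) \<in> automorphisms" and ij: "i < p" "j < p"
  shows "(\<rho> i, \<rho> j) \<in> adj \<longleftrightarrow> (i, j) \<in> adj"
proof -
  note a = automorphismD[OF aut]
  have "\<pi> ` (B i \<inter> B j) = B (\<rho> i) \<inter> B (\<rho> j)"
    using inj_on_image_Int[OF a(3) block_subset_points[OF ij(1)] block_subset_points[OF ij(2)]]
    by (simp add: a(4) ij)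
  then show ?thesis using ij a(5) by (auto simp: adj_def)
qed

lemma automorphism_image_component:
  assumes aut: "(\<rho>, \<pi>) \<in> automorphisms" and i: "i < p"
  shows "\<rho> ` component i = component (\<rho> i)"
proof
  note a = automorphismD[OF aut]
  show "\<rho> ` component i \<subseteq> component (\<rho> i)"
  proof
    fix k assume "k \<in> \<rho> ` component i"
    then obtain j where j: "(i, j) \<in> adj\<^sup>*" "k = \<rho> j" by (auto simp: component_def)
    from j(1) have "\<rho> j \<in> component (\<rho> i)"
    proof induction
      case (step y z)
      then have "y < p" "z < p" by (auto simp: adj_def)
      then show ?case using step component_step automorphism_adj[OF aut] by blast
    qed (rule component_self)
    then show "k \<in> component (\<rho> i)" using j(2) by simp
  qed
  show "component (\<rho> i) \<subseteq> \<rho> ` component i"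
  proof
    fix k assume "k \<in> component (\<rho> i)"
    then have "(\<rho> i, k) \<in> adj\<^sup>*" by (simp add: component_def)
    then show "k \<in> \<rho> ` component i"
    proof induction
      case base
      then show ?case using component_self by blast
    next
      case (step y z)
      then obtain y' where y': "y' \<in> component i" "y = \<rho> y'" by blast
      have "z < p" using step by (auto simp: adj_def)
      then obtain z' where z': "z' < p" "z = \<rho> z'"
        using permutes_image[OF a(1)] by (metis imageE lessThan_iff)
      have "y' < p" using y'(1) component_subset[OF i] by auto
      then have "(y', z') \<in> adj" using step(2) y' z' automorphism_adj[OF aut] by simp
      then show ?case using y'(1) z'(2) component_step by blast
    qed
  qed
qed

text \<open>The point map is an isomorphism between the components of \<open>i\<close> and of
  \<open>\<rho> i\<close>, so standardness makes them equal as multisets. Equal nonempty blocks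
  intersect, which brings the equality back to indices.\<close>

lemma standard_automorphism_component:
  assumes std: "standard_collection (fam_mset p B)"
    and aut: "(\<rho>, \<pi>) \<in> automorphisms" and i: "i < p"
  shows "\<rho> i \<in> component i"
proof -
  note a = automorphismD[OF aut]
  have \<rho>i: "\<rho> i < p" using a(5) i by simp
  let ?C = "\<lambda>i. image_mset B (mset_set (component i))"
  have fin: "finite (component j)" if "j < p" for j
    using component_subset[OF that] finite_subset by blast
  have sub: "component i \<subseteq> {..<p}" using component_subset[OF i] .
  have "image_mset ((`) \<pi>) (?C i) = image_mset B (image_mset \<rho> (mset_set (component i)))"
    unfolding multiset.map_comp using sub fin[OF i] a(4) by (intro image_mset_cong) auto
  also have "image_mset \<rho> (mset_set (component i)) = mset_set (component (\<rho> i))"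
    using permutes_inj_on[OF a(1)] automorphism_image_component[OF aut i] by (simp add: image_mset_mset_set)
  finally have img: "image_mset ((`) \<pi>) (?C i) = ?C (\<rho> i)" .
  have "\<Union>(set_mset (?C i)) \<subseteq> points"
    using sub fin[OF i] by (auto simp: points_def)
  then have "isomorphic_collections (?C i) (?C (\<rho> i))"
    using isomorphic_collections_map[of \<pi> "?C i"] img inj_on_subset[OF a(3)] by simp
  then have "?C i = ?C (\<rho> i)"
    using std connected_component_component[OF i] connected_component_component[OF \<rho>i]
    unfolding standard_collection_def by blast
  then have "B (\<rho> i) \<in># ?C i" using component_self fin[OF \<rho>i] by simp
  then obtain j where j: "j \<in> component i" "B (\<rho> i) = B j" using fin[OF i] by auto
  then have "(j, \<rho> i) \<in> adj" using sub \<rho>i block_nonempty[OF \<rho>i] by (auto simp: adj_def)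
  then show ?thesis using j(1) component_step by blast
qed

section \<open>Counting automorphisms by exploration\<close>

definition covered :: "nat set \<Rightarrow> nat set" where "covered J = (\<Union>j\<in>J. B j)"

text \<open>The image of \<open>automorphisms\<close> under \<open>restr J\<close> consists of the
  partial automorphisms visible once the blocks in \<open>J\<close> are explored; its size is
  bounded block by block.\<close>

definition restr :: "nat set \<Rightarrow> (nat \<Rightarrow> nat) \<times> (nat \<Rightarrow> nat) \<Rightarrow> (nat \<Rightarrow> nat) \<times> (nat \<Rightarrow> nat)" where
  "restr J a = (restrict (fst a) J, restrict (snd a) (covered J))"

lemma finite_automorphisms: "finite automorphisms"
proof (rule finite_subset)
  show "automorphisms \<subseteq> {\<rho>. \<rho> permutes {..<p}} \<times> (points \<rightarrow>\<^sub>E points)"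
    by (auto simp: automorphisms_def)
  show "finite ({\<rho>. \<rho> permutes {..<p}} \<times> (points \<rightarrow>\<^sub>E points))"
    using finite_points by (intro finite_cartesian_product finite_permutations finite_PiE) auto
qed

text \<open>Here \<open>R y\<close> is a set of candidates for the image of the index \<open>i\<close> under an automorphism
  whose restriction to the blocks in \<open>J\<close> is \<open>y\<close>.\<close>

lemma card_restr_insert_le:
  assumes J: "J \<subseteq> {..<p}" and i: "i < p" "i \<notin> J"
    and R: "\<And>a. a \<in> automorphisms \<Longrightarrow> fst a i \<in> R (restr J a)"
    and c: "\<And>y. y \<in> restr J ` automorphisms \<Longrightarrow> finite (R y) \<and> card (R y) \<le> c"
  shows "card (restr (insert i J) ` automorphisms)
    \<le> card (restr J ` automorphisms) * (c * fact (card (B i - covered J)))"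
proof -
  let ?T = "restr (insert i J) ` automorphisms"
  let ?D = "B i - covered J"
  have cov: "covered (insert i J) = covered J \<union> ?D" "covered J \<subseteq> covered (insert i J)"
    by (auto simp: covered_def)
  \<comment> \<open>Restricting in two stages makes the old restrictions an image of the new ones,
    so it is enough to bound the fibres.\<close>
  have rr: "restr J (restr (insert i J) a) = restr J a" for a
    using cov(2) by (auto simp: restr_def Int_absorb1 restrict_restrict insert_absorb)
  then have img: "restr J ` ?T = restr J ` automorphisms" by (simp add: image_image)
  have D: "finite ?D" using finite_block[OF i(1)] by simp
  have "card ?T \<le> card (restr J ` ?T) * (c * fact (card ?D))"
  proof (rule card_le_card_image_mult)
    fix y assume "y \<in> restr J ` ?T"
    then have y: "y \<in> restr J ` automorphisms" using img by simp
    \<comment> \<open>If \<open>i\<close> goes to \<open>t\<close>, the new points of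
      \<open>B i\<close> go bijectively onto the part of \<open>B t\<close> not yet used. Over a
      fixed \<open>y\<close>, the pair recorded by \<open>h\<close> determines the
      extension.\<close>
    define G where "G t = {f \<in> ?D \<rightarrow>\<^sub>E (B t - snd y ` covered J). bij_betw f ?D (B t - snd y ` covered J)}" for t
    define h where "h x = (fst x i, restrict (snd x) ?D)" for x :: "(nat \<Rightarrow> nat) \<times> (nat \<Rightarrow> nat)"
    let ?F = "{x \<in> ?T. restr J x = y}"
    have fin_G: "finite (G t)" if "t \<in> R y" "t < p" for t
      using finite_block[OF that(2)] D unfolding G_def
      by (intro finite_subset[OF _ finite_PiE[of ?D "\<lambda>_. B t - snd y ` covered J"]]) auto
    have "inj_on h ?F"
    proof (rule inj_onI)
      fix x x' assume x: "x \<in> ?F" "x' \<in> ?F" and eq: "h x = h x'"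
      from x have r: "restrict (fst x) J = restrict (fst x') J"
          "restrict (snd x) (covered J) = restrict (snd x') (covered J)"
        by (auto simp: restr_def)
      have s: "fst x i = fst x' i" "restrict (snd x) ?D = restrict (snd x') ?D"
        using eq by (auto simp: h_def)
      have ext: "fst z \<in> extensional (insert i J)" "snd z \<in> extensional (covered (insert i J))"
        if "z \<in> ?F" for z using that by (auto simp: restr_def)
      have "fst x k = fst x' k" if "k \<in> insert i J" for k
        using that s(1) fun_cong[OF r(1), of k] by auto
      moreover have "snd x k = snd x' k" if "k \<in> covered (insert i J)" for k
        using that fun_cong[OF s(2), of k] fun_cong[OF r(2), of k] unfolding cov(1)
        by (cases "k \<in> covered J") auto
      ultimately show "x = x'"
        using ext[OF x(1)] ext[OF x(2)] by (intro prod_eqI extensionalityI) auto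
    qed
    moreover have "h ` ?F \<subseteq> Sigma (R y \<inter> {..<p}) G"
    proof
      fix z assume "z \<in> h ` ?F"
      then obtain a where a: "a \<in> automorphisms" "z = h (restr (insert i J) a)" "restr J a = y"
        using rr by auto
      obtain \<rho> \<pi> where \<rho>\<pi>: "a = (\<rho>, \<pi>)" by fastforce
      note d = automorphismD[OF a(1)[unfolded \<rho>\<pi>]]
      have z: "z = (\<rho> i, restrict \<pi> ?D)"
        using a(2) cov(1) by (auto simp: h_def restr_def \<rho>\<pi> restrict_def)
      have sy: "snd y ` covered J = \<pi> ` covered J" using a(3) by (auto simp: restr_def \<rho>\<pi>)
      have "covered J \<subseteq> points" using J by (auto simp: covered_def points_def)
      then have "\<pi> ` ?D = B (\<rho> i) - \<pi> ` covered J"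
        using inj_on_image_set_diff[OF d(3), of "B i" "covered J"] block_subset_points[OF i(1)] d(4)[OF i(1)]
        by auto
      moreover have "inj_on \<pi> ?D"
        using d(3) block_subset_points[OF i(1)] by (auto intro: inj_on_subset)
      ultimately have "restrict \<pi> ?D \<in> G (\<rho> i)"
        by (auto simp: G_def sy bij_betw_def)
      moreover have "\<rho> i \<in> R y" using R[OF a(1)] a(3) by (simp add: \<rho>\<pi>)
      ultimately show "z \<in> Sigma (R y \<inter> {..<p}) G" using z d(5) i(1) by auto
    qed
    moreover have fin_S: "finite (Sigma (R y \<inter> {..<p}) G)" using fin_G c[OF y] by auto
    ultimately have "card ?F \<le> card (Sigma (R y \<inter> {..<p}) G)" by (rule card_inj_on_le)
    also have "\<dots> = (\<Sum>t\<in>R y \<inter> {..<p}. card (G t))"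
      using fin_G by (intro card_SigmaI) auto
    also have "\<dots> \<le> (\<Sum>t\<in>R y \<inter> {..<p}. fact (card ?D))"
      unfolding G_def by (intro sum_mono card_bijections_le D)
    also have "\<dots> \<le> c * fact (card ?D)"
      using c[OF y] card_mono[of "R y" "R y \<inter> {..<p}"] by (simp add: order_trans)
    finally show "card ?F \<le> c * fact (card ?D)" .
  qed (simp add: finite_automorphisms)
  then show ?thesis by (simp only: img)
qed

text \<open>Blocks are explored one at a time, preferring a block that meets the explored ones. The
  image of such a block is determined, since each point lies in exactly two blocks; only the first
  block of a component \<open>K\<close> leaves a choice, of at most \<open>card K \<le> 2 ^ card K\<close> images.\<close>

lemma exploration:
  assumes std: "standard_collection (fam_mset p B)" and "m \<le> p"
  shows "\<exists>J\<subseteq>{..<p}. card J = m \<and> card (restr J ` automorphisms) ^ l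
    \<le> fact l ^ card (covered J) * (2 ^ l) ^ card (\<Union>j\<in>J. component j)"
  using \<open>m \<le> p\<close>
\<comment> \<open>The bound concerns the \<open>l\<close>-th power because its natural form has the
  fractional exponent \<open>card (covered J) / l\<close> on \<open>fact l\<close>.\<close>
proof (induction m)
  case 0
  have "restr {} ` automorphisms \<subseteq> {restr {} undefined}" by (auto simp: restr_def covered_def)
  then have "card (restr {} ` automorphisms) \<le> 1"
    using card_mono[of "{restr {} undefined}"] by fastforce
  then have "card (restr {} ` automorphisms) ^ l \<le> 1" using power_mono[of _ 1 l] by fastforce
  then show ?case by (intro exI[of _ "{}"]) (simp add: covered_def)
next
  case (Suc m)
  then obtain J where J: "J \<subseteq> {..<p}" "card J = m"
    and IH: "card (restr J ` automorphisms) ^ l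
      \<le> fact l ^ card (covered J) * (2 ^ l) ^ card (\<Union>j\<in>J. component j)" by auto
  have finJ: "finite J" using J(1) finite_subset by blast
  let ?K = "\<lambda>J. \<Union>j\<in>J. component j"
  have "\<exists>i c. i < p \<and> i \<notin> J \<and> c * 2 ^ card (?K J) \<le> 2 ^ card (?K (insert i J)) \<and>
    card (restr (insert i J) ` automorphisms)
      \<le> card (restr J ` automorphisms) * (c * fact (card (B i - covered J)))"
  proof (cases "\<exists>i. i < p \<and> i \<notin> J \<and> B i \<inter> covered J \<noteq> {}")
    case True
    then obtain i j x where i: "i < p" "i \<notin> J" and j: "j \<in> J" and x: "x \<in> B i" "x \<in> B j"
      by (auto simp: covered_def)
    \<comment> \<open>The point \<open>x\<close> lies in \<open>B i\<close> and in
      \<open>B j\<close>, so the image of \<open>i\<close> is an index whose block contains the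
      image of \<open>x\<close>, other than the image of \<open>j\<close>. Only one such index
      exists.\<close>
    define R where "R y = {t \<in> {..<p}. snd y x \<in> B t} - {fst y j}" for y :: "(nat \<Rightarrow> nat) \<times> (nat \<Rightarrow> nat)"
    have jp: "j < p" using j J(1) by auto
    have xc: "x \<in> covered J" using j x(2) by (auto simp: covered_def)
    have "i \<in> component j"
      using component_step[OF component_self, of j i] i(1) jp x by (auto simp: adj_def)
    then have "?K (insert i J) = ?K J" using component_eq j by blast
    moreover have "card (restr (insert i J) ` automorphisms)
      \<le> card (restr J ` automorphisms) * (1 * fact (card (B i - covered J)))"
    proof (rule card_restr_insert_le[OF J(1) i, where R = R])
      fix a assume "a \<in> automorphisms"
      obtain \<rho> \<pi> where a: "a = (\<rho>, \<pi>)" by fastforce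
      note d = automorphismD[OF \<open>a \<in> automorphisms\<close>[unfolded a]]
      have "\<rho> i \<noteq> \<rho> j" using permutes_inj[OF d(1)] i(2) j by (auto dest: injD)
      then show "fst a i \<in> R (restr J a)"
        using j xc x(1) i(1) d(4)[OF i(1)] d(5) by (auto simp: R_def restr_def a)
    next
      fix y assume "y \<in> restr J ` automorphisms"
      then obtain \<rho> \<pi> where a: "(\<rho>, \<pi>) \<in> automorphisms" "y = restr J (\<rho>, \<pi>)" by auto
      note d = automorphismD[OF a(1)]
      have y: "snd y x = \<pi> x" "fst y j = \<rho> j" using j xc by (auto simp: a(2) restr_def)
      have "\<pi> x \<in> points" using d(2) x(1) block_subset_points[OF i(1)] by auto
      moreover have "\<rho> j \<in> {t \<in> {..<p}. \<pi> x \<in> B t}" using d(4)[OF jp] d(5) jp x(2) by auto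
      ultimately have "card (R y) = 1"
        using card_containing[of "\<pi> x"] by (simp add: R_def y)
      then show "finite (R y) \<and> card (R y) \<le> 1" by (simp add: R_def)
    qed
    ultimately show ?thesis using i by (intro exI[of _ i] exI[of _ 1]) simp
  next
    case False
    have "J \<noteq> {..<p}" using J(2) Suc.prems by auto
    then obtain i where i: "i < p" "i \<notin> J" using J(1) by auto
    \<comment> \<open>No unexplored block meets an explored one, so \<open>J\<close> is a union of
      components and the component of \<open>i\<close> is entirely new.\<close>
    have closed: "component j \<subseteq> J" if j: "j \<in> J" for j
    proof
      fix k assume "k \<in> component j"
      then have "(j, k) \<in> adj\<^sup>*" by (simp add: component_def)
      then show "k \<in> J"
      proof induction
        case (step y z)
        then show ?case using False by (auto simp: adj_def covered_def)
      qed (rule j)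
    qed
    have "component i \<inter> ?K J = {}"
    proof (rule ccontr)
      assume "component i \<inter> ?K J \<noteq> {}"
      then obtain j k where "j \<in> J" "k \<in> component i" "k \<in> component j" by blast
      then have "component i \<subseteq> J" using closed component_eq by blast
      then show False using component_self i(2) by blast
    qed
    moreover have fin: "finite (component i)" and "finite (?K J)"
      using component_subset J(1) i(1) finJ by (auto intro: finite_subset[OF _ finite_lessThan])
    ultimately have "card (?K (insert i J)) = card (component i) + card (?K J)"
      by (simp add: card_Un_disjoint)
    moreover have "card (component i) \<le> 2 ^ card (component i)" by (simp add: less_imp_le)
    ultimately have "card (component i) * 2 ^ card (?K J) \<le> 2 ^ card (?K (insert i J))"
      by (simp add: power_add)
    moreover have "card (restr (insert i J) ` automorphisms)
      \<le> card (restr J ` automorphisms) * (card (component i) * fact (card (B i - covered J)))"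
      using standard_automorphism_component[OF std _ i(1)] fin
      by (intro card_restr_insert_le[OF J(1) i, where R = "\<lambda>_. component i"]) auto
    ultimately show ?thesis using i by blast
  qed
  then obtain i c where i: "i < p" "i \<notin> J" and c: "c * 2 ^ card (?K J) \<le> 2 ^ card (?K (insert i J))"
    and le: "card (restr (insert i J) ` automorphisms)
      \<le> card (restr J ` automorphisms) * (c * fact (card (B i - covered J)))" by blast
  let ?f = "card (B i - covered J)"
  have "?f \<le> l" using card_mono[of "B i" "B i - covered J"] finite_block[OF i(1)] card_block[OF i(1)] by auto
  then have fact: "(fact ?f :: nat) ^ l \<le> fact l ^ ?f" by (rule fact_power_le)
  have "finite (covered J)" using J(1) finJ finite_block by (auto simp: covered_def)
  moreover have "covered (insert i J) = covered J \<union> (B i - covered J)" by (auto simp: covered_def)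
  ultimately have cov: "card (covered (insert i J)) = card (covered J) + ?f"
    using finite_block[OF i(1)] by (metis Diff_disjoint card_Un_disjoint finite_Diff)
  have "card (restr (insert i J) ` automorphisms) ^ l
    \<le> (card (restr J ` automorphisms) * (c * fact ?f)) ^ l" using le by (rule power_mono) simp
  also have "\<dots> = card (restr J ` automorphisms) ^ l * (c ^ l * fact ?f ^ l)"
    by (simp add: power_mult_distrib)
  also have "\<dots> \<le> (fact l ^ card (covered J) * (2 ^ l) ^ card (?K J)) * (c ^ l * fact l ^ ?f)"
    using IH fact by (intro mult_mono) auto
  also have "\<dots> = fact l ^ card (covered (insert i J)) * (c * 2 ^ card (?K J)) ^ l"
    by (simp add: cov power_add power_mult_distrib power_mult[symmetric] mult_ac)
  also have "\<dots> \<le> fact l ^ card (covered (insert i J)) * (2 ^ card (?K (insert i J))) ^ l"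
    using c by (intro mult_left_mono power_mono) auto
  also have "\<dots> = fact l ^ card (covered (insert i J)) * (2 ^ l) ^ card (?K (insert i J))"
    by (simp only: power_mult[symmetric] mult.commute)
  finally show ?case
    using i J finJ by (intro exI[of _ "insert i J"]) auto
qed

text \<open>Once all blocks are explored, restriction loses nothing, \<open>p div 2 * l\<close>
  points are covered and the components contain at most \<open>p\<close> indices. Taking
  \<open>l\<close>-th roots gives the bound.\<close>

lemma card_automorphisms_le:
  assumes std: "standard_collection (fam_mset p B)" and "even p"
  shows "card automorphisms \<le> fact l ^ (p div 2) * 2 ^ p"
proof -
  obtain J where J: "J \<subseteq> {..<p}" "card J = p"
    and le: "card (restr J ` automorphisms) ^ l
      \<le> fact l ^ card (covered J) * (2 ^ l) ^ card (\<Union>j\<in>J. component j)"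
    using exploration[OF std order_refl] by blast
  then have J_eq: "J = {..<p}" using card_subset_eq[of "{..<p}" J] by simp
  have cov: "covered J = points" by (simp add: covered_def points_def J_eq)
  have "card (\<Union>j\<in>J. component j) \<le> card {..<p}"
    using component_subset J(1) by (intro card_mono) auto
  then have K: "((2 :: nat) ^ l) ^ card (\<Union>j\<in>J. component j) \<le> (2 ^ l) ^ p"
    by (intro power_increasing) auto
  have "2 * card points = l * p"
    using card_points_double_covering[OF cover] by (simp add: points_def)
  then have pts: "card points = p div 2 * l" using \<open>even p\<close> by (auto elim: evenE)
  have "inj_on (restr J) automorphisms"
  proof (rule inj_onI)
    fix a a' assume a: "a \<in> automorphisms" "a' \<in> automorphisms" and eq: "restr J a = restr J a'"
    obtain \<rho> \<pi> \<rho>' \<pi>' where [simp]: "a = (\<rho>, \<pi>)" "a' = (\<rho>', \<pi>')" by fastforce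
    have r: "restrict \<rho> {..<p} = restrict \<rho>' {..<p}" "restrict \<pi> points = restrict \<pi>' points"
      using eq unfolding restr_def cov by (auto simp: J_eq)
    have "\<pi> = \<pi>'" using r(2) a automorphismD(2) by (metis PiE_restrict \<open>a = (\<rho>, \<pi>)\<close> \<open>a' = (\<rho>', \<pi>')\<close>)
    moreover have "\<rho> k = \<rho>' k" for k
    proof (cases "k < p")
      case True
      then show ?thesis using fun_cong[OF r(1), of k] by simp
    next
      case False
      have "\<rho> permutes {..<p}" "\<rho>' permutes {..<p}" using a automorphismD(1) by auto
      then show ?thesis using False by (metis lessThan_iff permutes_not_in)
    qed
    ultimately show "a = a'" by auto
  qed
  then have "card automorphisms ^ l = card (restr J ` automorphisms) ^ l" by (simp add: card_image)
  also have "\<dots> \<le> fact l ^ (p div 2 * l) * (2 ^ l) ^ p"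
    using le K unfolding cov pts by (meson mult_left_mono order_trans zero_le)
  also have "\<dots> = (fact l ^ (p div 2) * 2 ^ p) ^ l"
    by (simp add: power_mult_distrib power_mult[symmetric] mult.commute)
  finally show ?thesis using l_pos by (simp add: power_mono_iff)
qed

end

subsection \<open>The lower bound\<close>

context double_cover
begin

definition placements :: "nat set \<Rightarrow> (nat \<Rightarrow> nat) set" where
  "placements X = {\<phi> \<in> points \<rightarrow>\<^sub>E X. inj_on \<phi> points}"

definition placed_tuple :: "(nat \<Rightarrow> nat) \<times> (nat \<Rightarrow> nat) \<Rightarrow> nat \<Rightarrow> nat set" where
  "placed_tuple = (\<lambda>(\<sigma>, \<phi>). \<lambda>i\<in>{..<p}. \<phi> ` B (\<sigma> i))"

text \<open>The first two facts place the tuple among those counted by the moment; the third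
  recovers the E-class from the tuple.\<close>

lemma placed_tuple:
  assumes \<sigma>: "\<sigma> permutes {..<p}" and \<phi>: "\<phi> \<in> placements X"
  shows "placed_tuple (\<sigma>, \<phi>) \<in> {..<p} \<rightarrow>\<^sub>E {A. A \<subseteq> X \<and> card A = l}"
    and "even_cover {..<p} (placed_tuple (\<sigma>, \<phi>))"
    and "(fam_mset p B, fam_mset p (placed_tuple (\<sigma>, \<phi>))) \<in> iso_rel"
proof -
  have \<sigma>_less: "\<sigma> i < p" if "i < p" for i using permutes_in_image[OF \<sigma>, of i] that by simp
  have inj: "inj_on \<phi> points" and \<phi>X: "\<phi> ` points \<subseteq> X" using \<phi> by (auto simp: placements_def)
  have "\<phi> ` B i \<subseteq> X \<and> card (\<phi> ` B i) = l" if "i < p" for i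
    using \<phi>X block_subset_points[OF that] card_block[OF that]
    by (auto simp: card_image[OF inj_on_subset[OF inj]])
  then show "placed_tuple (\<sigma>, \<phi>) \<in> {..<p} \<rightarrow>\<^sub>E {A. A \<subseteq> X \<and> card A = l}"
    using \<sigma>_less by (auto simp: placed_tuple_def)
  show "(fam_mset p B, fam_mset p (placed_tuple (\<sigma>, \<phi>))) \<in> iso_rel"
    using inj finite_block
    by (intro iso_rel_famI[OF _ _ \<sigma>, where \<phi> = \<phi>]) (auto simp: placed_tuple_def points_def)
  show "even_cover {..<p} (placed_tuple (\<sigma>, \<phi>))"
    unfolding even_cover_def
  proof
    fix v
    have eq: "{i \<in> {..<p}. v \<in> placed_tuple (\<sigma>, \<phi>) i} = {i \<in> {..<p}. v \<in> \<phi> ` B (\<sigma> i)}"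
      by (auto simp: placed_tuple_def)
    show "even (card {i \<in> {..<p}. v \<in> placed_tuple (\<sigma>, \<phi>) i})"
    proof (cases "v \<in> \<phi> ` points")
      case True
      then obtain u where u: "u \<in> points" "v = \<phi> u" by blast
      have mem: "v \<in> \<phi> ` B j \<longleftrightarrow> u \<in> B j" if "j < p" for j
        using inj_on_image_mem_iff[OF inj u(1) block_subset_points[OF that]] u(2) by simp
      have "\<sigma> ` {i \<in> {..<p}. v \<in> \<phi> ` B (\<sigma> i)} = {j \<in> \<sigma> ` {..<p}. v \<in> \<phi> ` B j}" by blast
      also have "\<dots> = {j \<in> {..<p}. u \<in> B j}" using permutes_image[OF \<sigma>] mem by auto
      finally have "card {i \<in> {..<p}. v \<in> \<phi> ` B (\<sigma> i)} = card {j \<in> {..<p}. u \<in> B j}"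
        using card_image[OF permutes_inj_on[OF \<sigma>]] by metis
      then show ?thesis using card_containing[OF u(1)] eq by simp
    next
      case False
      then have "{i \<in> {..<p}. v \<in> \<phi> ` B (\<sigma> i)} = {}"
        using \<sigma>_less block_subset_points by blast
      then show ?thesis unfolding eq by (simp only: card.empty even_zero)
    qed
  qed
qed

text \<open>Two placements with the same image tuple differ by an automorphism.\<close>

lemma card_placed_tuple_fibre_le:
  "card {x \<in> {\<sigma>. \<sigma> permutes {..<p}} \<times> placements X. placed_tuple x = A} \<le> card automorphisms"
proof (cases "{x \<in> {\<sigma>. \<sigma> permutes {..<p}} \<times> placements X. placed_tuple x = A} = {}")
  case False
  let ?F = "{x \<in> {\<sigma>. \<sigma> permutes {..<p}} \<times> placements X. placed_tuple x = A}"
  obtain \<sigma>0 \<phi>0 where x0: "(\<sigma>0, \<phi>0) \<in> ?F" using False by auto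
  then have \<sigma>0: "\<sigma>0 permutes {..<p}" and \<phi>0: "inj_on \<phi>0 points"
    by (auto simp: placements_def)
  \<comment> \<open>Every pair in the fibre is compared with the fixed pair
    \<open>(\<sigma>0, \<phi>0)\<close>: going through one placement and back through the other is
    an automorphism.\<close>
  define h where "h = (\<lambda>(\<sigma> :: nat \<Rightarrow> nat, \<phi> :: nat \<Rightarrow> nat). (\<sigma>0 \<circ> inv \<sigma>, restrict (inv_into points \<phi>0 \<circ> \<phi>) points))"
  have blocks: "\<phi> ` B j = \<phi>0 ` B (\<sigma>0 (inv \<sigma> j))" if x: "(\<sigma>, \<phi>) \<in> ?F" and j: "j < p" for \<sigma> \<phi> j
  proof -
    have \<sigma>: "\<sigma> permutes {..<p}" using x by auto
    have i: "inv \<sigma> j < p" using permutes_in_image[OF permutes_inv[OF \<sigma>], of j] j by simp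
    have "placed_tuple (\<sigma>, \<phi>) (inv \<sigma> j) = placed_tuple (\<sigma>0, \<phi>0) (inv \<sigma> j)" using x x0 by auto
    then show ?thesis using i permutes_inverses(1)[OF \<sigma>] by (simp add: placed_tuple_def)
  qed
  have less: "\<sigma>0 (inv \<sigma> j) < p \<longleftrightarrow> j < p" if "(\<sigma>, \<phi>) \<in> ?F" for \<sigma> \<phi> j
    using permutes_in_image[OF permutes_inv, of \<sigma> "{..<p}" j] permutes_in_image[OF \<sigma>0, of "inv \<sigma> j"] that
    by auto
  have image: "\<phi> ` points \<subseteq> \<phi>0 ` points" if x: "(\<sigma>, \<phi>) \<in> ?F" for \<sigma> \<phi>
  proof
    fix v assume "v \<in> \<phi> ` points"
    then obtain j where "j < p" "v \<in> \<phi> ` B j" by (auto simp: points_def)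
    then show "v \<in> \<phi>0 ` points" using blocks[OF x] less[OF x] block_subset_points by blast
  qed
  have "inj_on h ?F"
  proof (rule inj_onI)
    fix x x' assume x: "x \<in> ?F" "x' \<in> ?F" and eq: "h x = h x'"
    obtain \<sigma> \<phi> \<sigma>' \<phi>' where xs: "x = (\<sigma>, \<phi>)" "x' = (\<sigma>', \<phi>')" by fastforce
    have "\<sigma>0 \<circ> inv \<sigma> = \<sigma>0 \<circ> inv \<sigma>'" using eq by (simp add: h_def xs)
    then have "inv \<sigma> = inv \<sigma>'" using permutes_inj[OF \<sigma>0] by (simp add: fun_eq_iff inj_eq)
    moreover have "bij \<sigma>" "bij \<sigma>'" using x by (auto simp: xs permutes_bij)
    ultimately have "\<sigma> = \<sigma>'" by (metis inv_inv_eq)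
    moreover have "\<phi> = \<phi>'"
    proof (rule extensionalityI[of _ points])
      show "\<phi> \<in> extensional points" "\<phi>' \<in> extensional points"
        using x by (auto simp: xs placements_def PiE_def)
      fix v assume v: "v \<in> points"
      have "inv_into points \<phi>0 (\<phi> v) = inv_into points \<phi>0 (\<phi>' v)"
        using eq v by (auto simp: h_def xs dest!: fun_cong[of _ _ v])
      moreover have "\<phi> v \<in> \<phi>0 ` points" "\<phi>' v \<in> \<phi>0 ` points"
        using image x v unfolding xs by blast+
      ultimately show "\<phi> v = \<phi>' v" by (metis f_inv_into_f)
    qed
    ultimately show "x = x'" by (simp add: xs)
  qed
  moreover have "h ` ?F \<subseteq> automorphisms"
  proof
    fix z assume "z \<in> h ` ?F"
    then obtain \<sigma> \<phi> where x: "(\<sigma>, \<phi>) \<in> ?F" and z: "z = h (\<sigma>, \<phi>)" by auto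
    define \<pi> where "\<pi> = restrict (inv_into points \<phi>0 \<circ> \<phi>) points"
    have \<sigma>: "\<sigma> permutes {..<p}" and \<phi>: "inj_on \<phi> points" using x by (auto simp: placements_def)
    have maps: "\<pi> \<in> points \<rightarrow>\<^sub>E points"
      using image[OF x] by (auto simp: \<pi>_def image_subset_iff intro!: inv_into_into)
    have "inj_on (inv_into points \<phi>0) (\<phi> ` points)" using image[OF x] by (rule inj_on_inv_into)
    then have "inj_on \<pi> points"
      unfolding \<pi>_def inj_on_restrict_eq by (rule comp_inj_on[OF \<phi>])
    moreover from this have "\<pi> ` points = points"
      using maps finite_points by (intro endo_inj_surj) auto
    moreover have "\<pi> ` B j = B (\<sigma>0 (inv \<sigma> j))" if j: "j < p" for j
    proof -
      have "\<pi> ` B j = inv_into points \<phi>0 ` \<phi> ` B j"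
        using block_subset_points[OF j] by (force simp: \<pi>_def)
      also have "\<dots> = B (\<sigma>0 (inv \<sigma> j))"
        unfolding blocks[OF x j] using less[OF x] j block_subset_points
        by (intro inv_into_image_cancel[OF \<phi>0]) auto
      finally show ?thesis .
    qed
    ultimately show "z \<in> automorphisms"
      using maps permutes_compose[OF permutes_inv[OF \<sigma>] \<sigma>0]
      by (auto simp: z h_def automorphisms_def bij_betw_def \<pi>_def[symmetric])
  qed
  ultimately show ?thesis using finite_automorphisms by (rule card_inj_on_le)
next
  case True
  then show ?thesis by (simp only: card.empty le0)
qed

text \<open>The falling factorial counts the injections of the points into \<open>X\<close>, and
  \<open>fact p\<close> the orders of the blocks; each tuple arises from at most
  \<open>card automorphisms\<close> such pairs.\<close>

lemma card_placed_tuples_ge: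
  assumes X: "finite X"
  shows "fact p * (\<Prod>i = 0..<card points. card X - i)
    \<le> card (placed_tuple ` ({\<sigma>. \<sigma> permutes {..<p}} \<times> placements X)) * card automorphisms"
proof -
  have "card (placements X) = (\<Prod>i = 0..<card points. card X - i)"
    unfolding placements_def using card_inj_on_subset_funcset[OF finite_points X order_refl] by simp
  moreover have "finite (placements X)"
    unfolding placements_def using X finite_points
    by (intro finite_subset[OF _ finite_PiE[of points "\<lambda>_. X"]]) auto
  then have "card ({\<sigma>. \<sigma> permutes {..<p}} \<times> placements X)
    \<le> card (placed_tuple ` ({\<sigma>. \<sigma> permutes {..<p}} \<times> placements X)) * card automorphisms"
    by (intro card_le_card_image_mult card_placed_tuple_fibre_le) (simp add: finite_permutations)
  moreover have "card {\<sigma>. \<sigma> permutes {..<p}} = fact p" by (rule card_permutations) auto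
  ultimately show ?thesis by (simp add: card_cartesian_product)
qed

end

text \<open>Tuples placed from a representative stay in its E-class, so distinct classes yield
  disjoint sets of tuples and the bounds for single classes add up.\<close>

lemma card_even_covers_ge:
  fixes X :: "nat set"
  assumes "l > 0" "even p" and X: "finite X"
  shows "mu_standard l p * (fact p * (\<Prod>i = 0..<p div 2 * l. card X - i))
    \<le> card {A \<in> {..<p} \<rightarrow>\<^sub>E {A. A \<subseteq> X \<and> card A = l}. even_cover {..<p} A} * (fact l ^ (p div 2) * 2 ^ p)"
proof -
  define D where "D = {\<A> \<in> double_coverings l p. standard_collection \<A>}"
  define E where "E = {A \<in> {..<p} \<rightarrow>\<^sub>E {A. A \<subseteq> X \<and> card A = l}. even_cover {..<p} A}"
  define M :: nat where "M = fact l ^ (p div 2) * 2 ^ p"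
  define P where "P = (\<Prod>i = 0..<p div 2 * l. card X - i)"
  have D: "D \<subseteq> double_coverings l p" by (auto simp: D_def)
  obtain rep where rep: "\<And>q. q \<in> D // iso_rel \<Longrightarrow> fam_mset p (rep q) \<in> D"
      "\<And>q. q \<in> D // iso_rel \<Longrightarrow> q = iso_rel `` {fam_mset p (rep q)}"
    using class_representatives[OF D] by metis
  define T where "T q = double_cover.placed_tuple p (rep q)
    ` ({\<sigma>. \<sigma> permutes {..<p}} \<times> double_cover.placements p (rep q) X)" for q
  have dc: "double_cover p l (rep q)" if "q \<in> D // iso_rel" for q
    using rep(1)[OF that] D \<open>l > 0\<close> by unfold_locales auto
  have T_E: "T q \<subseteq> E" if "q \<in> D // iso_rel" for q
    using double_cover.placed_tuple(1,2)[OF dc[OF that]] unfolding T_def E_def by blast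
  have T_class: "fam_mset p A \<in> q" if "q \<in> D // iso_rel" "A \<in> T q" for q A
    using double_cover.placed_tuple(3)[OF dc[OF that(1)]] rep(2)[OF that(1)] that(2)
    unfolding T_def by blast
  have "finite {A. A \<subseteq> X \<and> card A = l}" using X by simp
  then have E: "finite E" unfolding E_def
    by (intro finite_subset[OF _ finite_PiE[of "{..<p}" "\<lambda>_. {A. A \<subseteq> X \<and> card A = l}"]]) auto
  have finQ: "finite (D // iso_rel)"
    by (rule finite_subset[OF _ finite_double_covering_classes[of l p]]) (use D in \<open>auto simp: quotient_def\<close>)
  have D_carrier: "D // iso_rel \<subseteq> {\<A>. set_collection \<A>} // iso_rel"
    using D double_coverings_subset[of l p] by (auto simp: quotient_def)
  have disj: "T q \<inter> T q' = {}" if q: "q \<in> D // iso_rel" "q' \<in> D // iso_rel" "q \<noteq> q'" for q q'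
  proof -
    have "q \<inter> q' = {}" using quotient_disj[OF equiv_iso_rel] D_carrier q by blast
    then show ?thesis using T_class q by blast
  qed
  have each: "fact p * P \<le> card (T q) * M" if q: "q \<in> D // iso_rel" for q
  proof -
    interpret double_cover p l "rep q" by (rule dc[OF q])
    have "2 * card points = l * p"
      using card_points_double_covering[OF cover] by (simp add: points_def)
    then have "card points = p div 2 * l" using \<open>even p\<close> by (auto elim: evenE)
    then have "fact p * P \<le> card (T q) * card automorphisms"
      using card_placed_tuples_ge[OF X] by (simp add: P_def T_def)
    also have "\<dots> \<le> card (T q) * M"
      using card_automorphisms_le rep(1)[OF q] \<open>even p\<close> by (intro mult_left_mono) (auto simp: D_def M_def)
    finally show ?thesis .
  qed
  have "mu_standard l p * (fact p * P) = (\<Sum>q\<in>D // iso_rel. fact p * P)"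
    by (simp add: mu_standard_def D_def)
  also have "\<dots> \<le> (\<Sum>q\<in>D // iso_rel. card (T q) * M)" by (rule sum_mono[OF each])
  also have "\<dots> = card (\<Union>q\<in>D // iso_rel. T q) * M"
    using finQ disj finite_subset[OF T_E E] by (subst card_UN_disjoint) (auto simp: sum_distrib_right)
  also have "\<dots> \<le> card E * M" using T_E E by (intro mult_right_mono card_mono) auto
  finally show ?thesis by (simp add: P_def E_def M_def)
qed

text \<open>Each factor is at least \<open>n - v\<close>, and by Bernoulli's inequality
  \<open>(1 - v / n) ^ v\<close> is at least \<open>1 - v\<^sup>2 / n\<close>, which is 1/2 for this
  \<open>n\<close>.\<close>

lemma falling_factorial_ge:
  assumes "n = 2 * v\<^sup>2"
  shows "n ^ v \<le> 2 * (\<Prod>i = 0..<v. n - i)"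
proof (cases "v = 0")
  case False
  then have n: "n > 0" "v \<le> n" using assms by (auto simp: power2_eq_square)
  have "1 / 2 = 1 + real v * (- (real v / real n))"
    using False by (simp add: assms power2_eq_square field_simps)
  also have "\<dots> \<le> (1 - real v / real n) ^ v"
    using Bernoulli_inequality[of "- (real v / real n)" v] n by (simp add: field_simps)
  finally have "real n ^ v * (1 / 2) \<le> real n ^ v * (1 - real v / real n) ^ v"
    by (rule mult_left_mono) simp
  also have "\<dots> = (real n - real v) ^ v"
    using n by (simp add: power_mult_distrib[symmetric] field_simps)
  also have "\<dots> = (\<Prod>i = 0..<v. real n - real v)" by simp
  also have "\<dots> \<le> (\<Prod>i = 0..<v. real (n - i))" using n by (intro prod_mono) auto
  finally have "real (n ^ v) \<le> real (2 * (\<Prod>i = 0..<v. n - i))" by simp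
  then show ?thesis by (simp only: of_nat_le_iff)
qed simp

section \<open>From sums over even covers to norms\<close>

lemma powr_inverse_power:
  assumes "x \<ge> 0" "p > 0"
  shows "(x ^ p) powr (1 / real p) = (x :: real)"
  using assms by (cases "x = 0") (auto simp: powr_realpow[symmetric] powr_powr)

lemma Lp_norm_chaos_sum_le:
  assumes "p \<ge> 2" "even p" and b: "b \<in> finite_coeffs l" "coeff_norm l b \<le> 1"
  shows "Lp_norm (real p) (chaos_sum l b) \<le> sqrt (fact l) * (fact p * real (mu_full l p)) powr (1 / real p)"
proof -
  have "Lp_norm (real p) (chaos_sum l b) \<le> (sqrt (fact l) ^ p * (fact p * real (mu_full l p))) powr (1 / real p)"
    unfolding Lp_norm_chaos_sum[OF \<open>even p\<close> order_trans[OF one_le_numeral \<open>p \<ge> 2\<close>] b(1)]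
    using sum_even_cover_le[OF b] sum_even_cover_nonneg[OF \<open>even p\<close> b(1)]
    by (intro powr_mono2) auto
  also have "\<dots> = sqrt (fact l) * (fact p * real (mu_full l p)) powr (1 / real p)"
    using \<open>p \<ge> 2\<close> by (simp add: powr_mult powr_inverse_power)
  finally show ?thesis .
qed

lemma exists_large_Lp_norm:
  assumes "l > 0" "p \<ge> 2" "even p"
  obtains b where "b \<in> finite_coeffs l" "coeff_norm l b \<le> 1"
    "(fact p * real (mu_standard l p)) powr (1 / real p) / (2 * sqrt 3) \<le> Lp_norm (real p) (chaos_sum l b)"
proof -
  define k where "k = p div 2"
  have p: "p = 2 * k" "k \<ge> 1" using assms by (auto simp: k_def)
  \<comment> \<open>\<open>v\<close> is the number of points of a double covering, and
    \<open>n\<close> is chosen so that the falling factorial loses at most a factor 2 against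
    \<open>n ^ v\<close>.\<close>
  define v where "v = k * l"
  define n where "n = 2 * v\<^sup>2"
  have "l \<le> v" using p(2) by (simp add: v_def)
  also have "v \<le> n" by (simp add: n_def power2_eq_square)
  finally have "l \<le> n" .
  define F where "F = {A. A \<subseteq> {1..n} \<and> card A = l}"
  define C where "C = card F"
  define E where "E = {A \<in> {..<p} \<rightarrow>\<^sub>E F. even_cover {..<p} A}"
  \<comment> \<open>Constant coefficients of norm 1 turn the moment into the number of even covers
    divided by \<open>C ^ k\<close>.\<close>
  define b where "b A = (if A \<in> F then 1 / sqrt (real C) else 0)" for A
  have finF: "finite F" by (simp add: F_def)
  have C: "C = n choose l" unfolding C_def F_def using n_subsets[of "{1..n}" l] by simp
  have C0: "C > 0" using \<open>l \<le> n\<close> by (simp add: C)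
  have "F \<subseteq> index_sets l" by (auto simp: F_def index_sets_def intro: finite_subset)
  then have supp: "coeff_support l b = F" using C0 by (auto simp: coeff_support_def b_def)
  have norm: "coeff_norm l b = 1"
    using C0 by (simp add: coeff_norm_def supp b_def C_def[symmetric] power_divide)
  have fin: "b \<in> finite_coeffs l" by (simp add: finite_coeffs_def supp finF)
  have "mu_standard l p * (fact p * n ^ v) \<le> mu_standard l p * (fact p * (2 * (\<Prod>i = 0..<v. n - i)))"
    using falling_factorial_ge[OF n_def] by (intro mult_left_mono) auto
  also have "\<dots> \<le> 2 * (card E * (fact l ^ k * 2 ^ p))"
    using card_even_covers_ge[OF \<open>l > 0\<close> \<open>even p\<close>, of "{1..n}"]
    by (simp add: E_def F_def v_def k_def mult.left_commute)
  \<comment> \<open>The 2 lost in the falling factorial is absorbed by \<open>3 ^ k\<close>, where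
    \<open>k\<close> is at least 1; together with \<open>2 ^ p\<close> this makes up
    \<open>(2 * sqrt 3) ^ p\<close>.\<close>
  also have "\<dots> \<le> 3 ^ k * (card E * (fact l ^ k * 2 ^ p))"
    using p(2) power_increasing[of 1 k "3 :: nat"] by (intro mult_right_mono) auto
  finally have upper: "mu_standard l p * (fact p * n ^ v) \<le> 3 ^ k * (card E * (fact l ^ k * 2 ^ p))" .
  \<comment> \<open>This replaces \<open>n ^ v\<close> by \<open>C ^ k * fact l ^ k\<close>, whose
    second factor cancels the one in the bound for automorphisms.\<close>
  have "(C * fact l) ^ k \<le> (n ^ l) ^ k"
    unfolding C by (intro power_mono binomial_fact_pow) simp
  then have "C ^ k * fact l ^ k \<le> n ^ v" by (simp add: v_def power_mult_distrib power_mult[symmetric] mult.commute)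
  then have "mu_standard l p * (fact p * (C ^ k * fact l ^ k)) \<le> 3 ^ k * (card E * (fact l ^ k * 2 ^ p))"
    using upper by (meson mult_le_mono2 order_trans)
  then have "fact l ^ k * (mu_standard l p * (fact p * C ^ k)) \<le> fact l ^ k * (card E * (3 ^ k * 2 ^ p))"
    by (simp add: mult_ac)
  then have "mu_standard l p * (fact p * C ^ k) \<le> card E * (3 ^ k * 2 ^ p)" by simp
  then have "real (mu_standard l p * (fact p * C ^ k)) \<le> real (card E * (3 ^ k * 2 ^ p))"
    by (simp only: of_nat_le_iff)
  moreover have "(2 * sqrt 3) ^ p = 3 ^ k * 2 ^ p"
    by (simp add: p(1) power_mult_distrib power_mult[of "sqrt 3"])
  ultimately have le: "fact p * real (mu_standard l p) / (2 * sqrt 3) ^ p \<le> real (card E) / real C ^ k"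
    using C0 by (simp add: field_simps)
  have "(\<Sum>A\<in>E. \<Prod>i<p. b (A i)) = (\<Sum>A\<in>E. (1 / sqrt (real C)) ^ p)"
  proof (rule sum.cong[OF refl])
    fix A assume "A \<in> E"
    then have "b (A i) = 1 / sqrt (real C)" if "i < p" for i using that by (auto simp: E_def b_def)
    then show "(\<Prod>i<p. b (A i)) = (1 / sqrt (real C)) ^ p" by simp
  qed
  also have "\<dots> = real (card E) / real C ^ k"
    by (simp add: p(1) power_mult power_divide)
  finally have sum: "(\<Sum>A\<in>E. \<Prod>i<p. b (A i)) = real (card E) / real C ^ k" .
  have "(fact p * real (mu_standard l p)) powr (1 / real p) / (2 * sqrt 3)
    = (fact p * real (mu_standard l p) / (2 * sqrt 3) ^ p) powr (1 / real p)"
    using \<open>p \<ge> 2\<close> powr_inverse_power[of "2 * sqrt 3" p] by (simp add: powr_divide)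
  also have "\<dots> \<le> (real (card E) / real C ^ k) powr (1 / real p)"
    using le by (intro powr_mono2) auto
  also have "\<dots> = Lp_norm (real p) (chaos_sum l b)"
    using Lp_norm_chaos_sum[OF \<open>even p\<close> _ fin] \<open>p \<ge> 2\<close> sum by (simp add: supp E_def)
  finally show ?thesis using that fin norm by simp
qed

text \<open>The supremum is taken in \<open>ereal\<close>, where it exists without a prior bound on
  the norms.\<close>

theorem theorem1p3:
  fixes l p :: nat
  assumes "l \<ge> 2" and "p \<ge> 2" and "even p"
  shows "ereal ((fact p * real (mu_standard l p)) powr (1 / real p) / (2 * sqrt 3))
           \<le> (SUP b \<in> {b \<in> finite_coeffs l. coeff_norm l b \<le> 1}.
                ereal (Lp_norm (real p) (chaos_sum l b)))
       \<and> (SUP b \<in> {b \<in> finite_coeffs l. coeff_norm l b \<le> 1}.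
                ereal (Lp_norm (real p) (chaos_sum l b)))
           \<le> ereal (sqrt (fact l) * (fact p * real (mu_full l p)) powr (1 / real p))"
proof
  have "l > 0" using assms(1) by simp
  then obtain b where "b \<in> {b \<in> finite_coeffs l. coeff_norm l b \<le> 1}"
    "(fact p * real (mu_standard l p)) powr (1 / real p) / (2 * sqrt 3) \<le> Lp_norm (real p) (chaos_sum l b)"
    using exists_large_Lp_norm[OF _ assms(2,3)] by blast
  then show "ereal ((fact p * real (mu_standard l p)) powr (1 / real p) / (2 * sqrt 3))
    \<le> (SUP b \<in> {b \<in> finite_coeffs l. coeff_norm l b \<le> 1}. ereal (Lp_norm (real p) (chaos_sum l b)))"
    by (intro SUP_upper2) auto
  show "(SUP b \<in> {b \<in> finite_coeffs l. coeff_norm l b \<le> 1}. ereal (Lp_norm (real p) (chaos_sum l b)))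
    \<le> ereal (sqrt (fact l) * (fact p * real (mu_full l p)) powr (1 / real p))"
    using Lp_norm_chaos_sum_le[OF assms(2,3)] by (intro SUP_least) auto
qed

end
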